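(* Let $A$ be a symmetric tensor of type $(1,1)$ on an oriented Riemannian manifold $M^n$, $n\ge 2$, with $g$ distinct eigenvalues $\lambda_1,\dots,\lambda_g$ having constant multiplicities $m_1,\dots,m_g$, respectively. Then for each point $p\in M$ there exists an orthonormal frame of differentiable eigenvectors $\{X_1,\dots,X_n\}$ of $A$ defined in a neighborhood $U$ of $p$ in $M$.
   Context: Tensors are smooth; symmetric means $\langle AX,Y\rangle=\langle X,AY\rangle$ for all tangent vectors $X,Y$ at the same point. The eigenvalues $\lambda_i$ are functions on $M$, pairwise distinct at every point, and $\lambda_i$ has multiplicity $m_i$ at every point. *)

theory Defs
  imports "HOL-Analysis.Analysis" "HOL-Library.Function_Algebras"
begin

instantiation "fun" :: (type, real_vector) real_vector
begin

definition scaleR_fun :: "real \<Rightarrow> ('a \<Rightarrow> 'b) \<Rightarrow> 'a \<Rightarrow> 'b"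
  where "scaleR_fun r f = (\<lambda>x. r *\<^sub>R f x)"

instance
  by standard (auto simp: scaleR_fun_def plus_fun_def fun_eq_iff algebra_simps)

end


section \<open>Smooth maps between Euclidean spaces\<close>

(* Only meant for open S in a finite-dimensional space; continuity of all iterated
   directional derivatives is then the usual notion of class C^k. *)
primrec Ck_on ::
  "nat \<Rightarrow> ('a::euclidean_space \<Rightarrow> 'b::real_normed_vector) \<Rightarrow> 'a set \<Rightarrow> bool" where
  "Ck_on 0 f S \<longleftrightarrow> continuous_on S f"
| "Ck_on (Suc k) f S \<longleftrightarrow>
     (\<forall>x\<in>S. f differentiable (at x)) \<and>
     (\<forall>v. Ck_on k (\<lambda>x. frechet_derivative f (at x) v) S)"

definition smooth_on :: "('a::euclidean_space \<Rightarrow> 'b::real_normed_vector) \<Rightarrow> 'a set \<Rightarrow> bool"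
  where "smooth_on f S \<longleftrightarrow> (\<forall>k. Ck_on k f S)"


section \<open>Smooth manifolds\<close>

(* A chart is a domain together with a coordinate map; the values of the map outside the
   domain are irrelevant. The dimension of the manifold is CARD('n). *)
type_synonym ('a, 'n) chart = "'a set \<times> ('a \<Rightarrow> real ^ 'n)"

abbreviation chart_dom :: "('a, 'n) chart \<Rightarrow> 'a set"
  where "chart_dom c \<equiv> fst c"

abbreviation chart_map :: "('a, 'n) chart \<Rightarrow> 'a \<Rightarrow> real ^ 'n"
  where "chart_map c \<equiv> snd c"

definition chart_inv :: "('a, 'n) chart \<Rightarrow> real ^ 'n \<Rightarrow> 'a"
  where "chart_inv c = inv_into (chart_dom c) (chart_map c)"

definition is_chart :: "'a topology \<Rightarrow> ('a, 'n::finite) chart \<Rightarrow> bool"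
  where "is_chart M c \<longleftrightarrow>
    openin M (chart_dom c) \<and>
    open (chart_map c ` chart_dom c) \<and>
    homeomorphic_map (subtopology M (chart_dom c))
      (top_of_set (chart_map c ` chart_dom c)) (chart_map c)"

(* The coordinate change from c to d; relevant only on the image under c of the overlap. *)
definition transition :: "('a, 'n) chart \<Rightarrow> ('a, 'n) chart \<Rightarrow> real ^ 'n \<Rightarrow> real ^ 'n"
  where "transition c d = chart_map d \<circ> chart_inv c"

(* The differential of the coordinate change from c to d, at the coordinates of p. *)
definition transition_deriv ::
  "('a, 'n::finite) chart \<Rightarrow> ('a, 'n) chart \<Rightarrow> 'a \<Rightarrow> real ^ 'n \<Rightarrow> real ^ 'n"
  where "transition_deriv c d p = frechet_derivative (transition c d) (at (chart_map c p))"

definition compatible :: "('a, 'n::finite) chart \<Rightarrow> ('a, 'n) chart \<Rightarrow> bool"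
  where "compatible c d \<longleftrightarrow>
    smooth_on (transition c d) (chart_map c ` (chart_dom c \<inter> chart_dom d)) \<and>
    smooth_on (transition d c) (chart_map d ` (chart_dom c \<inter> chart_dom d))"

definition smooth_manifold :: "'a topology \<Rightarrow> ('a, 'n::finite) chart set \<Rightarrow> bool"
  where "smooth_manifold M \<A> \<longleftrightarrow>
    Hausdorff_space M \<and> second_countable M \<and>
    (\<forall>c\<in>\<A>. is_chart M c) \<and>
    (\<Union>c\<in>\<A>. chart_dom c) = topspace M \<and>
    (\<forall>c\<in>\<A>. \<forall>d\<in>\<A>. compatible c d) \<and>
    (\<forall>c. is_chart M c \<and> (\<forall>d\<in>\<A>. compatible c d) \<longrightarrow> c \<in> \<A>)"

(* An orientation is given by any oriented atlas contained in the smooth structure. *)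
definition orientation ::
  "'a topology \<Rightarrow> ('a, 'n::finite) chart set \<Rightarrow> ('a, 'n) chart set \<Rightarrow> bool"
  where "orientation M \<A> \<O> \<longleftrightarrow>
    \<O> \<subseteq> \<A> \<and>
    (\<Union>c\<in>\<O>. chart_dom c) = topspace M \<and>
    (\<forall>c\<in>\<O>. \<forall>d\<in>\<O>. \<forall>p\<in>chart_dom c \<inter> chart_dom d.
       0 < det (matrix (transition_deriv c d p)))"


section \<open>Tangent vectors and vector fields\<close>

(* A tangent vector at p assigns to every chart around p a coordinate vector, transforming
   by the differential of the coordinate change. Charts not containing p are sent to 0, so
   that the tangent space is a linear subspace of the function space. *)
type_synonym ('a, 'n) tvec = "('a, 'n) chart \<Rightarrow> real ^ 'n"

definition tangent_space :: "('a, 'n::finite) chart set \<Rightarrow> 'a \<Rightarrow> ('a, 'n) tvec set"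
  where "tangent_space \<A> p = {v.
    (\<forall>c. \<not> (c \<in> \<A> \<and> p \<in> chart_dom c) \<longrightarrow> v c = 0) \<and>
    (\<forall>c\<in>\<A>. \<forall>d\<in>\<A>. p \<in> chart_dom c \<inter> chart_dom d \<longrightarrow>
       v d = transition_deriv c d p (v c))}"

(* The i-th coordinate vector of the chart c at p. *)
definition coord_vec :: "('a, 'n::finite) chart set \<Rightarrow> ('a, 'n) chart \<Rightarrow> 'n \<Rightarrow> 'a \<Rightarrow> ('a, 'n) tvec"
  where "coord_vec \<A> c i p = (\<lambda>d.
    if d \<in> \<A> \<and> p \<in> chart_dom d then transition_deriv c d p (axis i 1) else 0)"

definition smooth_vector_field_on ::
  "('a, 'n::finite) chart set \<Rightarrow> 'a set \<Rightarrow> ('a \<Rightarrow> ('a, 'n) tvec) \<Rightarrow> bool"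
  where "smooth_vector_field_on \<A> U X \<longleftrightarrow>
    (\<forall>p\<in>U. X p \<in> tangent_space \<A> p) \<and>
    (\<forall>c\<in>\<A>. smooth_on (\<lambda>x. X (chart_inv c x) c) (chart_map c ` (U \<inter> chart_dom c)))"


section \<open>Riemannian metrics and tensors of type (1,1)\<close>

definition riemannian_metric ::
  "'a topology \<Rightarrow> ('a, 'n::finite) chart set \<Rightarrow>
   ('a \<Rightarrow> ('a, 'n) tvec \<Rightarrow> ('a, 'n) tvec \<Rightarrow> real) \<Rightarrow> bool"
  where "riemannian_metric M \<A> G \<longleftrightarrow>
    (\<forall>p\<in>topspace M. \<forall>u\<in>tangent_space \<A> p. \<forall>v\<in>tangent_space \<A> p.
       G p u v = G p v u \<and>
       (\<forall>w\<in>tangent_space \<A> p. G p (u + v) w = G p u w + G p v w) \<and>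
       (\<forall>r. G p (r *\<^sub>R u) v = r * G p u v) \<and>
       (u \<noteq> 0 \<longrightarrow> 0 < G p u u)) \<and>
    (\<forall>c\<in>\<A>. \<forall>i j. smooth_on
       (\<lambda>x. let q = chart_inv c x in G q (coord_vec \<A> c i q) (coord_vec \<A> c j q))
       (chart_map c ` chart_dom c))"

definition oriented_riemannian_manifold ::
  "'a topology \<Rightarrow> ('a, 'n::finite) chart set \<Rightarrow> ('a, 'n) chart set \<Rightarrow>
   ('a \<Rightarrow> ('a, 'n) tvec \<Rightarrow> ('a, 'n) tvec \<Rightarrow> real) \<Rightarrow> bool"
  where "oriented_riemannian_manifold M \<A> \<O> G \<longleftrightarrow>
    smooth_manifold M \<A> \<and> orientation M \<A> \<O> \<and> riemannian_metric M \<A> G"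

definition smooth_tensor_1_1 ::
  "'a topology \<Rightarrow> ('a, 'n::finite) chart set \<Rightarrow>
   ('a \<Rightarrow> ('a, 'n) tvec \<Rightarrow> ('a, 'n) tvec) \<Rightarrow> bool"
  where "smooth_tensor_1_1 M \<A> A \<longleftrightarrow>
    (\<forall>p\<in>topspace M. \<forall>u\<in>tangent_space \<A> p.
       A p u \<in> tangent_space \<A> p \<and>
       (\<forall>v\<in>tangent_space \<A> p. A p (u + v) = A p u + A p v) \<and>
       (\<forall>r. A p (r *\<^sub>R u) = r *\<^sub>R A p u)) \<and>
    (\<forall>c\<in>\<A>. \<forall>i j. smooth_on
       (\<lambda>x. let q = chart_inv c x in A q (coord_vec \<A> c j q) c $ i)
       (chart_map c ` chart_dom c))"

definition symmetric_tensor ::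
  "'a topology \<Rightarrow> ('a, 'n::finite) chart set \<Rightarrow>
   ('a \<Rightarrow> ('a, 'n) tvec \<Rightarrow> ('a, 'n) tvec \<Rightarrow> real) \<Rightarrow>
   ('a \<Rightarrow> ('a, 'n) tvec \<Rightarrow> ('a, 'n) tvec) \<Rightarrow> bool"
  where "symmetric_tensor M \<A> G A \<longleftrightarrow>
    (\<forall>p\<in>topspace M. \<forall>u\<in>tangent_space \<A> p. \<forall>v\<in>tangent_space \<A> p.
       G p (A p u) v = G p u (A p v))"


section \<open>Eigenvectors and frames\<close>

definition eigenspace_at ::
  "('a, 'n::finite) chart set \<Rightarrow> ('a \<Rightarrow> ('a, 'n) tvec \<Rightarrow> ('a, 'n) tvec) \<Rightarrow>
   'a \<Rightarrow> real \<Rightarrow> ('a, 'n) tvec set"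
  where "eigenspace_at \<A> A p \<mu> = {v \<in> tangent_space \<A> p. A p v = \<mu> *\<^sub>R v}"

definition eigenvector_at ::
  "('a, 'n::finite) chart set \<Rightarrow> ('a \<Rightarrow> ('a, 'n) tvec \<Rightarrow> ('a, 'n) tvec) \<Rightarrow>
   'a \<Rightarrow> real \<Rightarrow> ('a, 'n) tvec \<Rightarrow> bool"
  where "eigenvector_at \<A> A p \<mu> v \<longleftrightarrow> v \<in> eigenspace_at \<A> A p \<mu> \<and> v \<noteq> 0"

definition eigenvalue_at ::
  "('a, 'n::finite) chart set \<Rightarrow> ('a \<Rightarrow> ('a, 'n) tvec \<Rightarrow> ('a, 'n) tvec) \<Rightarrow>
   'a \<Rightarrow> real \<Rightarrow> bool"
  where "eigenvalue_at \<A> A p \<mu> \<longleftrightarrow> (\<exists>v. eigenvector_at \<A> A p \<mu> v)"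

(* No regularity of the functions lam i is required. For a symmetric operator the algebraic
   multiplicity of an eigenvalue is the dimension of its eigenspace. *)
definition distinct_eigenvalues_with_multiplicities ::
  "'a topology \<Rightarrow> ('a, 'n::finite) chart set \<Rightarrow>
   ('a \<Rightarrow> ('a, 'n) tvec \<Rightarrow> ('a, 'n) tvec) \<Rightarrow>
   nat \<Rightarrow> (nat \<Rightarrow> 'a \<Rightarrow> real) \<Rightarrow> (nat \<Rightarrow> nat) \<Rightarrow> bool"
  where "distinct_eigenvalues_with_multiplicities M \<A> A g lam m \<longleftrightarrow>
    (\<forall>p\<in>topspace M.
       {\<mu>. eigenvalue_at \<A> A p \<mu>} = {lam i p |i. i \<in> {1..g}} \<and>
       inj_on (\<lambda>i. lam i p) {1..g} \<and>
       (\<forall>i\<in>{1..g}. dim (eigenspace_at \<A> A p (lam i p)) = m i))"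

definition smooth_frame_on ::
  "('a, 'n::finite) chart set \<Rightarrow> 'a set \<Rightarrow> (nat \<Rightarrow> 'a \<Rightarrow> ('a, 'n) tvec) \<Rightarrow> bool"
  where "smooth_frame_on \<A> U X \<longleftrightarrow>
    (\<forall>i\<in>{1..CARD('n)}. smooth_vector_field_on \<A> U (X i)) \<and>
    (\<forall>p\<in>U. inj_on (\<lambda>i. X i p) {1..CARD('n)} \<and>
       independent ((\<lambda>i. X i p) ` {1..CARD('n)}) \<and>
       span ((\<lambda>i. X i p) ` {1..CARD('n)}) = tangent_space \<A> p)"

definition smooth_orthonormal_frame_on ::
  "('a, 'n::finite) chart set \<Rightarrow>
   ('a \<Rightarrow> ('a, 'n) tvec \<Rightarrow> ('a, 'n) tvec \<Rightarrow> real) \<Rightarrow>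
   'a set \<Rightarrow> (nat \<Rightarrow> 'a \<Rightarrow> ('a, 'n) tvec) \<Rightarrow> bool"
  where "smooth_orthonormal_frame_on \<A> G U X \<longleftrightarrow>
    smooth_frame_on \<A> U X \<and>
    (\<forall>p\<in>U. \<forall>i\<in>{1..CARD('n)}. \<forall>j\<in>{1..CARD('n)}.
       G p (X i p) (X j p) = (if i = j then 1 else 0))"

end

theory Submission
  imports Defs
begin

text \<open>
  In a chart, \<open>A\<close> becomes a smooth family \<open>L x\<close> of operators on \<open>\<real>\<^sup>n\<close>, self-adjoint for a smooth family
  \<open>B x\<close> of inner products. The functions \<open>\<lambda>\<^sub>i\<close> need not be continuous, but because the number of distinct
  eigenvalues is constant, the eigenvalues of \<open>L x\<close> near \<open>p\<close> form continuous branches \<open>\<rho>\<^sub>i\<close>. If \<open>w\<close> is an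
  eigenvector of \<open>L p\<close> for \<open>\<rho>\<^sub>i p\<close>, then \<open>q x = (\<Prod>j\<noteq>i. L x - \<rho>\<^sub>j x) w\<close> is a nonvanishing eigenvector field near \<open>p\<close>,
  and \<open>\<partial>\<rho>\<^sub>i = B(q, (\<partial>L) q) / B(q, q)\<close>. This formula only needs \<open>q\<close> to be continuous, and bootstraps the
  regularity of the \<open>\<rho>\<^sub>i\<close>, hence of \<open>q\<close>, to \<open>C\<^sup>\<infinity>\<close>. Gram--Schmidt finally produces an
  orthonormal frame.
\<close>

section \<open>Calculus of smooth maps\<close>

text \<open>A derivative at \<open>x\<close> depends on all values near \<open>x\<close>; agreement
  on \<open>S\<close> carries it over because \<open>S\<close> is open. This lets a map be replaced
  by its expansion in a basis.\<close>

lemma Ck_on_cong_imp: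
  assumes "open S" "\<And>x. x \<in> S \<Longrightarrow> f x = g x" "Ck_on k f S"
  shows "Ck_on k g S"
  using assms(2,3)
proof (induction k arbitrary: f g)
  case 0
  then show ?case using continuous_on_cong[OF refl, of S f g] by auto
next
  case (Suc k)
  have der: "(g has_derivative frechet_derivative f (at x)) (at x)" if "x \<in> S" for x
  proof (rule has_derivative_transform_within_open[OF _ assms(1) that])
    show "(f has_derivative frechet_derivative f (at x)) (at x)"
      using Suc.prems(2) that by (simp add: frechet_derivative_works)
  qed (use Suc.prems(1) in blast)
  then have eq: "frechet_derivative g (at x) = frechet_derivative f (at x)" if "x \<in> S" for x
    using frechet_derivative_at that by metis
  have "Ck_on k (\<lambda>x. frechet_derivative g (at x) v) S" for v
    by (rule Suc.IH[of "\<lambda>x. frechet_derivative f (at x) v"]) (use eq Suc.prems in auto)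
  then show ?case
    using der by (auto simp: differentiable_def)
qed

text \<open>Derivatives are unique, so an explicit candidate \<open>f'\<close> may stand in for
  \<open>frechet_derivative\<close>.\<close>

lemma Ck_on_SucI:
  assumes "open S" "\<And>x. x \<in> S \<Longrightarrow> (f has_derivative f' x) (at x)"
    "\<And>v. Ck_on k (\<lambda>x. f' x v) S"
  shows "Ck_on (Suc k) f S"
proof -
  have eq: "frechet_derivative f (at x) = f' x" if "x \<in> S" for x
    using frechet_derivative_at assms(2) that by metis
  have "Ck_on k (\<lambda>x. frechet_derivative f (at x) v) S" for v
    using Ck_on_cong_imp[OF assms(1) _ assms(3)[of v]] eq by simp
  then show ?thesis
    using assms(2) by (auto simp: differentiable_def)
qed

lemma Ck_on_has_derivative:
  assumes "Ck_on (Suc k) f S" "x \<in> S"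
  shows "(f has_derivative frechet_derivative f (at x)) (at x)"
  using assms by (simp add: frechet_derivative_works)

lemma Ck_on_SucD: "Ck_on (Suc k) f S \<Longrightarrow> Ck_on k f S"
proof (induction k arbitrary: f)
  case 0
  then show ?case
    by (auto intro!: continuous_at_imp_continuous_on differentiable_imp_continuous_within)
qed (metis Ck_on.simps(2))

lemma Ck_on_subset: "Ck_on k f S \<Longrightarrow> T \<subseteq> S \<Longrightarrow> Ck_on k f T"
  by (induction k arbitrary: f) (auto intro: continuous_on_subset)

lemma smooth_on_subset: "smooth_on f S \<Longrightarrow> T \<subseteq> S \<Longrightarrow> smooth_on f T"
  by (auto simp: smooth_on_def intro: Ck_on_subset)

lemma smooth_on_has_derivative:
  "smooth_on f S \<Longrightarrow> x \<in> S \<Longrightarrow> (f has_derivative frechet_derivative f (at x)) (at x)"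
  using Ck_on_has_derivative smooth_on_def by metis

lemma smooth_on_frechet_derivative:
  "smooth_on f S \<Longrightarrow> smooth_on (\<lambda>x. frechet_derivative f (at x) v) S"
  unfolding smooth_on_def by (metis Ck_on.simps(2))

lemma Ck_on_const: "open S \<Longrightarrow> Ck_on k (\<lambda>x. c) S"
proof (induction k arbitrary: c)
  case (Suc k)
  show ?case
    by (rule Ck_on_SucI[where f' = "\<lambda>x v. 0"]) (use Suc in auto)
qed auto

lemma Ck_on_add:
  "open S \<Longrightarrow> Ck_on k f S \<Longrightarrow> Ck_on k g S \<Longrightarrow> Ck_on k (\<lambda>x. f x + g x) S"
proof (induction k arbitrary: f g)
  case (Suc k)
  show ?case
    by (rule Ck_on_SucI[where f' = "\<lambda>x v. frechet_derivative f (at x) v + frechet_derivative g (at x) v"])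
       (use Suc in \<open>auto intro!: has_derivative_add Ck_on_has_derivative\<close>)
qed (auto intro: continuous_on_add)

lemma Ck_on_sum:
  "open S \<Longrightarrow> (\<And>i. i \<in> I \<Longrightarrow> Ck_on k (f i) S) \<Longrightarrow> Ck_on k (\<lambda>x. \<Sum>i\<in>I. f i x) S"
  by (induction I rule: infinite_finite_induct) (auto intro!: Ck_on_add Ck_on_const)

text \<open>By the product rule the derivative is a sum of two terms of the same form with
  \<open>C^k\<close> arguments, so the induction closes. One proof serves scaling, multiplication
  and the inner product.\<close>

lemma Ck_on_bilinear:
  assumes "bounded_bilinear h" "open S"
  shows "Ck_on k f S \<Longrightarrow> Ck_on k g S \<Longrightarrow> Ck_on k (\<lambda>x. h (f x) (g x)) S"
proof (induction k arbitrary: f g)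
  case 0
  then show ?case using bounded_bilinear.continuous_on[OF assms(1)] by auto
next
  case (Suc k)
  show ?case
  proof (rule Ck_on_SucI[OF assms(2)])
    fix v
    show "Ck_on k (\<lambda>x. h (f x) (frechet_derivative g (at x) v) + h (frechet_derivative f (at x) v) (g x)) S"
      using Suc.prems by (intro Ck_on_add assms Suc.IH Suc.prems[THEN Ck_on_SucD]) auto
  next
    fix x assume "x \<in> S"
    then show "((\<lambda>x. h (f x) (g x)) has_derivative
        (\<lambda>v. h (f x) (frechet_derivative g (at x) v) + h (frechet_derivative f (at x) v) (g x))) (at x)"
      by (intro bounded_bilinear.FDERIV[OF assms(1)] Suc.prems[THEN Ck_on_has_derivative])
  qed
qed

lemmas Ck_on_scaleR = Ck_on_bilinear[OF bounded_bilinear_scaleR]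
  and Ck_on_mult = Ck_on_bilinear[OF bounded_bilinear_mult]
  and Ck_on_inner = Ck_on_bilinear[OF bounded_bilinear_inner]

lemma Ck_on_minus:
  assumes "open S" "Ck_on k f S" "Ck_on k g S"
  shows "Ck_on k (\<lambda>x. f x - g x) S"
  using Ck_on_add[OF assms(1,2) Ck_on_scaleR[OF assms(1) Ck_on_const[OF assms(1)] assms(3)],
      of "-1"] by simp

text \<open>The derivative of \<open>1/f\<close> is a product of \<open>1/f\<close>,
  \<open>f'\<close> and \<open>1/f\<close>, so the induction hypothesis for \<open>1/f\<close>
  itself supplies its regularity.\<close>

lemma Ck_on_inverse:
  fixes f :: "'a::euclidean_space \<Rightarrow> real"
  assumes "open S" "\<And>x. x \<in> S \<Longrightarrow> f x \<noteq> 0"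
  shows "Ck_on k f S \<Longrightarrow> Ck_on k (\<lambda>x. inverse (f x)) S"
proof (induction k)
  case 0
  then show ?case using assms by (auto intro: continuous_on_inverse)
next
  case (Suc k)
  show ?case
  proof (rule Ck_on_SucI[OF assms(1)])
    fix v
    show "Ck_on k (\<lambda>x. (-1) * (inverse (f x) * frechet_derivative f (at x) v * inverse (f x))) S"
      using Suc by (intro Ck_on_mult Ck_on_const assms Suc.IH Suc.prems[THEN Ck_on_SucD]) auto
  next
    fix x assume "x \<in> S"
    then show "((\<lambda>x. inverse (f x)) has_derivative
        (\<lambda>v. (-1) * (inverse (f x) * frechet_derivative f (at x) v * inverse (f x)))) (at x)"
      using Deriv.has_derivative_inverse[OF assms(2) Ck_on_has_derivative[OF Suc.prems]] by simp
  qed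
qed

text \<open>The function \<open>h = 1 / sqrt f\<close> satisfies \<open>h' = - h^3 f' / 2\<close>, a
  polynomial in \<open>h\<close> and \<open>f'\<close>; hence the same induction as for the inverse.
  It normalizes vector fields later.\<close>

lemma Ck_on_rsqrt:
  fixes f :: "'a::euclidean_space \<Rightarrow> real"
  assumes "open S" "\<And>x. x \<in> S \<Longrightarrow> f x > 0"
  shows "Ck_on k f S \<Longrightarrow> Ck_on k (\<lambda>x. inverse (sqrt (f x))) S"
proof (induction k)
  case 0
  then show ?case using assms by (fastforce intro!: continuous_intros)
next
  case (Suc k)
  let ?h = "\<lambda>x. inverse (sqrt (f x))"
  show ?case
  proof (rule Ck_on_SucI[OF assms(1)])
    fix v
    show "Ck_on k (\<lambda>x. (-1/2) * (?h x * (?h x * (?h x * frechet_derivative f (at x) v)))) S"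
      using Suc by (intro Ck_on_mult Ck_on_const assms Suc.IH Suc.prems[THEN Ck_on_SucD]) auto
  next
    fix x assume x: "x \<in> S"
    have "(?h has_derivative (\<lambda>v. - (inverse (sqrt (f x)) *
        (frechet_derivative f (at x) v * (inverse (sqrt (f x)) / 2)) * inverse (sqrt (f x))))) (at x)"
      using Deriv.has_derivative_inverse[OF _ has_derivative_real_sqrt[OF assms(2)[OF x]
          Ck_on_has_derivative[OF Suc.prems x]]] assms(2)[OF x]
      by (simp add: field_simps)
    then show "(?h has_derivative
        (\<lambda>v. (-1/2) * (?h x * (?h x * (?h x * frechet_derivative f (at x) v))))) (at x)"
      by (simp add: mult_ac)
  qed
qed

text \<open>The chain rule applies the outer derivative to a moving direction. Expanding that
  direction in the basis leaves only derivatives of \<open>f\<close> in fixed directions, to which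
  the induction hypothesis applies.\<close>

lemma Ck_on_compose:
  fixes f :: "'b::euclidean_space \<Rightarrow> 'c::real_normed_vector" and s :: "'a::euclidean_space \<Rightarrow> 'b"
  assumes "open S" "open T" "s ` S \<subseteq> T"
  shows "Ck_on k f T \<Longrightarrow> Ck_on k s S \<Longrightarrow> Ck_on k (\<lambda>x. f (s x)) S"
proof (induction k arbitrary: f)
  case 0
  then show ?case using assms continuous_on_compose2[of T f S s] by auto
next
  case (Suc k)
  let ?Df = "\<lambda>x. frechet_derivative f (at x)" and ?Ds = "\<lambda>x. frechet_derivative s (at x)"
  have df: "(f has_derivative ?Df (s x)) (at (s x))" if "x \<in> S" for x
    using Ck_on_has_derivative[OF Suc.prems(1)] assms(3) that by blast
  show ?case
  proof (rule Ck_on_SucI[OF assms(1)])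
    fix v
    have 1: "Ck_on k (\<lambda>x. ?Df (s x) b) S" for b
      using Suc.IH[OF _ Ck_on_SucD[OF Suc.prems(2)], of "\<lambda>z. ?Df z b"] Suc.prems(1) by simp
    have 2: "Ck_on k (\<lambda>x. ?Ds x v) S"
      using Suc.prems(2) by simp
    show "Ck_on k (\<lambda>x. \<Sum>b\<in>Basis. (?Ds x v \<bullet> b) *\<^sub>R ?Df (s x) b) S"
      by (intro Ck_on_sum Ck_on_scaleR Ck_on_inner Ck_on_const assms 1 2)
  next
    fix x assume x: "x \<in> S"
    have lin: "linear (?Df (s x))"
      using df[OF x] has_derivative_linear by blast
    have rep: "?Df (s x) w = (\<Sum>b\<in>Basis. (w \<bullet> b) *\<^sub>R ?Df (s x) b)" for w
      using linear_sum[OF lin, of "\<lambda>b. (w \<bullet> b) *\<^sub>R b" Basis]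
      by (simp add: linear_scale[OF lin] euclidean_representation)
    show "((\<lambda>x. f (s x)) has_derivative (\<lambda>v. \<Sum>b\<in>Basis. (?Ds x v \<bullet> b) *\<^sub>R ?Df (s x) b)) (at x)"
      using diff_chain_at[OF Ck_on_has_derivative[OF Suc.prems(2) x] df[OF x]]
      unfolding o_def rep[symmetric] .
  qed
qed

section \<open>Self-adjoint operators\<close>

text \<open>The operator \<open>(T - r1) ... (T - rn)\<close>, a polynomial in \<open>T\<close>
  given by the list of its roots.\<close>

primrec shift_prod :: "('b::real_vector \<Rightarrow> 'b) \<Rightarrow> real list \<Rightarrow> 'b \<Rightarrow> 'b" where
  "shift_prod T [] v = v"
| "shift_prod T (r # rs) v = T (shift_prod T rs v) - r *\<^sub>R shift_prod T rs v"

lemma linear_shift_prod: "linear T \<Longrightarrow> linear (shift_prod T rs)"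
proof (induction rs)
  case Nil
  show ?case by (rule linearI) auto
next
  case (Cons r rs)
  then show ?case by (intro linearI) (simp_all add: linear_add linear_scale algebra_simps)
qed

lemma shift_prod_commute: "linear T \<Longrightarrow> T (shift_prod T rs v) = shift_prod T rs (T v)"
  by (induction rs) (simp_all add: linear_diff linear_scale)

lemma shift_prod_eigen:
  "linear T \<Longrightarrow> T v = \<mu> *\<^sub>R v \<Longrightarrow> shift_prod T rs v = (\<Prod>r\<leftarrow>rs. \<mu> - r) *\<^sub>R v"
  by (induction rs) (simp_all add: linear_scale algebra_simps)

text \<open>The form \<open>B\<close> is kept apart from the inner product of the type because it
  will vary with a parameter. The Euclidean structure supplies the compact sphere, the dimension and
  a fixed basis.\<close>

locale self_adjoint_op =
  fixes B :: "'b::euclidean_space \<Rightarrow> 'b \<Rightarrow> real" and L :: "'b \<Rightarrow> 'b"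
  assumes bilin: "bilinear B" and sym: "B u v = B v u" and pos: "v \<noteq> 0 \<Longrightarrow> 0 < B v v"
    and lin: "linear L" and adj: "B (L u) v = B u (L v)"
begin

lemmas bilin_simps = bilinear_ladd[OF bilin] bilinear_radd[OF bilin] bilinear_lsub[OF bilin]
  bilinear_rsub[OF bilin] bilinear_lmul[OF bilin] bilinear_rmul[OF bilin]
  bilinear_lzero[OF bilin] bilinear_rzero[OF bilin]

lemma eq_0_iff: "B v v = 0 \<longleftrightarrow> v = 0"
  using pos[of v] bilin_simps(7)[of 0] by (cases "v = 0") auto

text \<open>Minimizes the Rayleigh quotient of \<open>L\<close> over the unit sphere of \<open>V\<close>.\<close>

lemma eigenvector_in_invariant:
  assumes V: "subspace V" "v0 \<in> V" "v0 \<noteq> 0" and inv: "\<And>v. v \<in> V \<Longrightarrow> L v \<in> V"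
  obtains v \<mu> where "v \<in> V" "v \<noteq> 0" "L v = \<mu> *\<^sub>R v" "\<mu> * B v0 v0 \<le> B (L v0) v0"
proof -
  let ?K = "V \<inter> sphere 0 1" and ?f = "\<lambda>v. B (L v) v / B v v"
  have bb: "bounded_bilinear B"
    using bilin bilinear_conv_bounded_bilinear by blast
  have cL: "continuous_on T L" for T
    using lin linear_conv_bounded_linear linear_continuous_on by blast
  have "compact ?K"
    using closed_Int_compact[OF closed_subspace[OF V(1)] compact_sphere] .
  moreover have "(1 / norm v0) *\<^sub>R v0 \<in> ?K"
    using V by (auto simp: subspace_scale)
  moreover have "continuous_on ?K ?f"
    by (intro continuous_on_divide bounded_bilinear.continuous_on[OF bb] cL continuous_on_id)
      (auto simp: eq_0_iff)
  ultimately obtain v where v: "v \<in> ?K" "\<And>u. u \<in> ?K \<Longrightarrow> ?f v \<le> ?f u"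
    using continuous_attains_inf[of ?K ?f] by blast
  define \<mu> where "\<mu> = ?f v"
  have v0: "v \<noteq> 0" using v by auto
  \<comment> \<open>The quotient does not change under scaling, so its minimum on the unit sphere of
    \<open>V\<close> is a bound on all of \<open>V\<close>.\<close>
  have min: "\<mu> * B u u \<le> B (L u) u" if "u \<in> V" for u
  proof (cases "u = 0")
    case False
    let ?u = "(1 / norm u) *\<^sub>R u"
    have "?u \<in> ?K" using that V(1) False by (auto simp: subspace_scale)
    then have "\<mu> \<le> ?f ?u" using v(2) \<mu>_def by blast
    also have "?f ?u = ?f u"
      using False by (simp add: linear_scale[OF lin] bilin_simps)
    finally show ?thesis using pos[OF False] by (simp add: field_simps)
  qed (simp add: bilin_simps)
  \<comment> \<open>The residual of \<open>v\<close> lies in \<open>V\<close>, so minimality can be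
    tested along the line \<open>v + t w\<close>. The first-order term there is
    \<open>2 t B w w\<close>, which forces \<open>w = 0\<close>.\<close>
  define w where "w = L v - \<mu> *\<^sub>R v"
  have wV: "w \<in> V"
    unfolding w_def using v(1) inv V(1) by (auto intro: subspace_diff subspace_scale)
  define d where "d = B (L w) w - \<mu> * B w w"
  have d: "d \<ge> 0" using min[OF wV] d_def by simp
  have v_eq: "B (L v) v = \<mu> * B v v"
    using v0 eq_0_iff by (simp add: \<mu>_def)
  have ineq: "0 \<le> 2 * t * B w w + t\<^sup>2 * d" for t
  proof -
    have 1: "v + t *\<^sub>R w \<in> V"
      using v(1) wV V(1) by (auto intro: subspace_add subspace_scale)
    have 2: "B (L w) v = B w (L v)" by (rule adj)
    have 3: "B v w = B w v" "B (L v) w = B w (L v)" by (rule sym)+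
    have 4: "B w (L v) - \<mu> * B w v = B w w"
    proof -
      have "B w w = B w (L v - \<mu> *\<^sub>R v)" by (simp only: w_def[symmetric])
      then show ?thesis by (simp only: bilin_simps real_scaleR_def)
    qed
    have "B (L (v + t *\<^sub>R w)) (v + t *\<^sub>R w) - \<mu> * B (v + t *\<^sub>R w) (v + t *\<^sub>R w)
      = 2 * t * (B w (L v) - \<mu> * B w v) + t\<^sup>2 * d"
      by (simp add: linear_add[OF lin] linear_scale[OF lin] bilin_simps 2 3 v_eq d_def
          algebra_simps power2_eq_square)
    then show ?thesis using min[OF 1] 4 by simp
  qed
  have "w = 0"
  proof (rule ccontr)
    assume "w \<noteq> 0"
    then have b: "B w w > 0" by (rule pos)
    let ?b = "B w w"
    \<comment> \<open>The choice \<open>t = - B w w / (d + 1)\<close> makes the quadratic negative;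
      adding 1 keeps the denominator positive when \<open>d = 0\<close>.\<close>
    have "2 * (- ?b / (d + 1)) * ?b + (- ?b / (d + 1))\<^sup>2 * d = - ?b\<^sup>2 * (d + 2) / (d + 1)\<^sup>2"
      using d by (simp add: power2_eq_square divide_simps) (simp add: algebra_simps)
    also have "\<dots> < 0"
      using b d by (intro divide_neg_pos mult_neg_pos) auto
    finally show False using ineq[of "- ?b / (d + 1)"] by simp
  qed
  then show ?thesis
    using that[of v \<mu>] v(1) v0 min[OF V(2)] by (auto simp: w_def)
qed

lemma shift_prod_adj: "B (shift_prod L rs u) v = B u (shift_prod L rs v)"
proof (induction rs arbitrary: u v)
  case (Cons r rs)
  then show ?case
    by (simp add: bilin_simps adj shift_prod_commute[OF lin])
qed simp

text \<open>A nonzero range of the product would be an invariant subspace and contain an eigenvector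
  \<open>u\<close>. The product kills \<open>u\<close>, since the eigenvalue of \<open>u\<close> is
  among the roots. Being self-adjoint, the product is injective on its own range, so
  \<open>u = 0\<close>.\<close>

lemma shift_prod_eq_0:
  assumes "\<And>\<mu> v. v \<noteq> 0 \<Longrightarrow> L v = \<mu> *\<^sub>R v \<Longrightarrow> \<mu> \<in> set rs"
  shows "shift_prod L rs v = 0"
proof (rule ccontr)
  let ?T = "shift_prod L rs"
  assume nz: "?T v \<noteq> 0"
  have "subspace (range ?T)"
    using linear_subspace_image[OF linear_shift_prod[OF lin] subspace_UNIV] .
  moreover have "L u \<in> range ?T" if "u \<in> range ?T" for u
    using that shift_prod_commute[OF lin] by auto
  ultimately obtain u \<mu> where u: "u \<in> range ?T" "u \<noteq> 0" "L u = \<mu> *\<^sub>R u"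
    using eigenvector_in_invariant[of "range ?T" "?T v"] nz by (metis rangeI)
  then obtain x where x: "u = ?T x" by auto
  have "?T u = 0"
    using assms[OF u(2,3)] by (simp add: shift_prod_eigen[OF lin u(3)] prod_list_zero_iff)
  then have "B u u = 0"
    unfolding x by (simp add: shift_prod_adj[of _ _ "?T x"] bilin_simps)
  then show False using u(2) eq_0_iff by blast
qed

text \<open>The least eigenvalue \<open>\<theta>\<close> of \<open>(L - r)\<^sup>2\<close> is at most its Rayleigh quotient at \<open>v\<close>, and \<open>L\<close> has an
  eigenvector in the \<open>\<theta>\<close>-eigenspace of \<open>(L - r)\<^sup>2\<close>.\<close>

lemma near_eigenvalue:
  assumes "v \<noteq> 0" "B (L v - r *\<^sub>R v) (L v - r *\<^sub>R v) < \<delta>\<^sup>2 * B v v" "\<delta> > 0"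
  obtains u \<mu> where "u \<noteq> 0" "L u = \<mu> *\<^sub>R u" "\<bar>\<mu> - r\<bar> < \<delta>"
proof -
  let ?M = "shift_prod L [r, r]"
  interpret M: self_adjoint_op B ?M
    by (rule self_adjoint_op.intro) (fact bilin sym pos linear_shift_prod[OF lin] shift_prod_adj)+
  obtain w \<theta> where w: "w \<noteq> 0" "?M w = \<theta> *\<^sub>R w" "\<theta> * B v v \<le> B (?M v) v"
    using M.eigenvector_in_invariant[of UNIV v] assms(1) subspace_UNIV by blast
  \<comment> \<open>One factor \<open>L - r\<close> is moved to the other argument, which turns the
    form into the squared \<open>B\<close>-length of the residual \<open>L v - r v\<close>.\<close>
  have "B (?M v) v = B (shift_prod L [r] v) (shift_prod L [r] v)"
    using shift_prod_adj[of "[r]" "shift_prod L [r] v" v] by simp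
  also have "\<dots> < \<delta>\<^sup>2 * B v v" using assms(2) by simp
  finally have \<theta>: "\<theta> < \<delta>\<^sup>2"
    using w(3) pos[OF assms(1)] by (meson mult_less_cancel_right_pos order_le_less_trans)
  let ?V = "{u. ?M u = \<theta> *\<^sub>R u}"
  have "subspace ?V"
    using M.lin by (auto simp: subspace_def linear_add linear_scale linear_0 algebra_simps
        simp del: shift_prod.simps)
  moreover have "w \<in> ?V" using w(2) by blast
  moreover have "L u \<in> ?V" if "u \<in> ?V" for u
    using that shift_prod_commute[OF lin, of "[r, r]" u, symmetric]
    by (simp add: linear_scale[OF lin] del: shift_prod.simps)
  ultimately obtain u \<mu> where u: "u \<in> ?V" "u \<noteq> 0" "L u = \<mu> *\<^sub>R u"
    by (rule eigenvector_in_invariant[OF _ _ w(1)])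
  have "?M u = (\<mu> - r)\<^sup>2 *\<^sub>R u"
    using shift_prod_eigen[OF lin u(3), of "[r, r]"] by (simp add: power2_eq_square del: shift_prod.simps)
  then have "(\<mu> - r)\<^sup>2 = \<theta>"
    using u(1,2) by (simp del: shift_prod.simps)
  then have "\<bar>\<mu> - r\<bar> < \<delta>"
    using \<theta> assms(3) by (metis abs_of_pos power2_less_imp_less power2_abs abs_ge_zero less_imp_le)
  then show ?thesis using that u by blast
qed

lemma eigenvectors_orthogonal:
  assumes "L u = \<mu> *\<^sub>R u" "L v = \<nu> *\<^sub>R v" "\<mu> \<noteq> \<nu>"
  shows "B u v = 0"
  using adj[of u v] assms by (simp add: bilin_simps)

section \<open>Orthonormal systems and their extension by eigenvectors\<close>

definition orthonormal :: "nat \<Rightarrow> (nat \<Rightarrow> 'b) \<Rightarrow> bool" where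
  "orthonormal k \<xi> \<longleftrightarrow> (\<forall>i<k. \<forall>j<k. B (\<xi> i) (\<xi> j) = (if i = j then 1 else 0))"

text \<open>Pairing with \<open>\<xi> i\<close> vanishes on the span of the other vectors but equals
  1 at \<open>\<xi> i\<close>.\<close>

lemma orthonormal_independent:
  assumes "orthonormal k \<xi>"
  shows "inj_on \<xi> {..<k}" "independent (\<xi> ` {..<k})"
proof -
  have on: "B (\<xi> i) (\<xi> j) = (if i = j then 1 else 0)" if "i < k" "j < k" for i j
    using assms that by (auto simp: orthonormal_def)
  show inj: "inj_on \<xi> {..<k}"
    using on by (intro inj_onI) (metis lessThan_iff zero_neq_one)
  show "independent (\<xi> ` {..<k})"
    unfolding dependent_def
  proof clarify
    fix i assume i: "i < k" "\<xi> i \<in> span (\<xi> ` {..<k} - {\<xi> i})"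
    have "subspace {w. B w (\<xi> i) = 0}"
      by (auto simp: subspace_def bilin_simps)
    then have "span (\<xi> ` {..<k} - {\<xi> i}) \<subseteq> {w. B w (\<xi> i) = 0}"
      using on i(1) by (intro span_minimal) auto
    then show False using i on[OF i(1) i(1)] by auto
  qed
qed

text \<open>The vectors that equal their expansion form a subspace containing every
  \<open>\<xi> j\<close>, and these are independent and as many as the dimension.\<close>

lemma orthonormal_expand:
  assumes "orthonormal (DIM('b)) \<xi>"
  shows "u = (\<Sum>i<DIM('b). B u (\<xi> i) *\<^sub>R \<xi> i)"
proof -
  let ?n = "DIM('b)" let ?V = "{u. u = (\<Sum>i<?n. B u (\<xi> i) *\<^sub>R \<xi> i)}"
  have "card (\<xi> ` {..<?n}) = ?n"
    using orthonormal_independent(1)[OF assms] by (simp add: card_image)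
  then have "UNIV \<subseteq> span (\<xi> ` {..<?n})"
    using orthonormal_independent(2)[OF assms] by (intro card_ge_dim_independent) auto
  moreover have "subspace ?V"
  proof -
    have "(\<Sum>i<?n. B (c *\<^sub>R x) (\<xi> i) *\<^sub>R \<xi> i) = c *\<^sub>R (\<Sum>i<?n. B x (\<xi> i) *\<^sub>R \<xi> i)" for c x
      by (simp add: bilin_simps scaleR_sum_right)
    then show ?thesis
      by (auto simp: subspace_def bilin_simps scaleR_add_left sum.distrib)
  qed
  moreover have "\<xi> j \<in> ?V" if j: "j < ?n" for j
  proof -
    have "(\<Sum>i<?n. B (\<xi> j) (\<xi> i) *\<^sub>R \<xi> i) = (\<Sum>i<?n. if j = i then \<xi> i else 0)"
      using assms j by (intro sum.cong) (auto simp: orthonormal_def)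
    then show ?thesis using j by simp
  qed
  ultimately have "UNIV \<subseteq> ?V"
    using span_minimal[of "\<xi> ` {..<?n}" ?V] by fast
  then show ?thesis by blast
qed

text \<open>The \<open>B\<close>-orthogonal complement of eigenvectors is invariant under a
  self-adjoint operator, and it is nonzero while \<open>k\<close> is below the dimension; so it
  contains an eigenvector.\<close>

lemma next_eigenvector:
  assumes on: "orthonormal k \<xi>" and k: "k < DIM('b)"
    and eig: "\<And>i. i < k \<Longrightarrow> \<exists>\<mu>. L (\<xi> i) = \<mu> *\<^sub>R \<xi> i"
  obtains w \<mu> where "w \<noteq> 0" "L w = \<mu> *\<^sub>R w" "\<And>i. i < k \<Longrightarrow> B w (\<xi> i) = 0"
proof -
  let ?W = "{w. \<forall>i<k. B w (\<xi> i) = 0}"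
  have "dim (span (\<xi> ` {..<k})) \<le> card (\<xi> ` {..<k})"
    using dim_le_card[of "span (\<xi> ` {..<k})" "\<xi> ` {..<k}"] by simp
  also have "\<dots> < DIM('b)"
    using card_image_le[of "{..<k}" \<xi>] k by simp
  finally have "span (\<xi> ` {..<k}) \<noteq> UNIV"
    using dim_UNIV by (metis less_irrefl)
  then obtain u where u: "u \<notin> span (\<xi> ` {..<k})" by blast
  \<comment> \<open>Subtracting the projection from a vector outside the span leaves a nonzero
    element of the complement.\<close>
  define w0 where "w0 = u - (\<Sum>i<k. B u (\<xi> i) *\<^sub>R \<xi> i)"
  have w0: "w0 \<noteq> 0"
  proof
    assume "w0 = 0"
    then have "u = (\<Sum>i<k. B u (\<xi> i) *\<^sub>R \<xi> i)" by (simp add: w0_def)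
    also have "\<dots> \<in> span (\<xi> ` {..<k})"
      by (intro span_sum span_scale span_base) auto
    finally show False using u by blast
  qed
  have "B w0 (\<xi> j) = 0" if j: "j < k" for j
  proof -
    have l: "linear (\<lambda>w. B w (\<xi> j))" using bilin by (simp add: bilinear_def)
    have "B (\<Sum>i<k. B u (\<xi> i) *\<^sub>R \<xi> i) (\<xi> j) = (\<Sum>i<k. if j = i then B u (\<xi> i) else 0)"
      unfolding linear_sum[OF l]
      using on j by (intro sum.cong) (auto simp: orthonormal_def bilin_simps)
    then show ?thesis using j by (simp add: w0_def bilin_simps)
  qed
  then have "w0 \<in> ?W" by blast
  have "subspace ?W"
    by (auto simp: subspace_def bilin_simps)
  moreover note \<open>w0 \<in> ?W\<close>
  moreover have "L w \<in> ?W" if w: "w \<in> ?W" for w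
  proof clarify
    fix i assume i: "i < k"
    then obtain \<mu> where "L (\<xi> i) = \<mu> *\<^sub>R \<xi> i" using eig by blast
    then show "B (L w) (\<xi> i) = 0" using w i by (simp add: adj bilin_simps)
  qed
  ultimately obtain w \<mu> where "w \<in> ?W" "w \<noteq> 0" "L w = \<mu> *\<^sub>R w"
    by (rule eigenvector_in_invariant[OF _ _ w0])
  then show ?thesis using that by blast
qed

end

section \<open>Smooth families of self-adjoint operators\<close>

definition eigenvalues :: "('b::real_vector \<Rightarrow> 'b) \<Rightarrow> real set" where
  "eigenvalues T = {\<mu>. \<exists>v. v \<noteq> 0 \<and> T v = \<mu> *\<^sub>R v}"

text \<open>In the product rule the term with the derivative of \<open>f\<close> carries the factor
  \<open>h x = 0\<close>, so continuity of \<open>f\<close> suffices. This is how merely continuous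
  eigenvector fields become usable.\<close>

lemma has_derivative_mult_vanishing:
  fixes f h :: "'a::real_normed_vector \<Rightarrow> real"
  assumes f: "isCont f x" and h: "(h has_derivative h') (at x)" and h0: "h x = 0"
  shows "((\<lambda>y. f y * h y) has_derivative (\<lambda>v. f x * h' v)) (at x)"
proof -
  have bl: "bounded_linear h'" using h has_derivative_bounded_linear by blast
  obtain K where K: "\<And>v. norm (h' v) \<le> norm v * K"
    using bounded_linear.bounded[OF bl] by blast
  have f0: "((\<lambda>y. f y - f x) \<longlongrightarrow> 0) (at x)"
    using f LIM_zero isCont_def by blast
  \<comment> \<open>The remainder splits as
    \<open>f y (h y - h' (y - x)) + (f y - f x) h' (y - x)\<close>. The first part is small by
    differentiability of \<open>h\<close>, the second by continuity of \<open>f\<close> and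
    boundedness of \<open>h'\<close>.\<close>
  have 1: "((\<lambda>y. f y * ((h y - h' (y - x)) / norm (y - x))) \<longlongrightarrow> 0) (at x)"
    using tendsto_mult[OF f[unfolded isCont_def], of "\<lambda>y. (h y - h' (y - x)) / norm (y - x)" 0] h h0
    by (simp add: has_derivative_at_within divide_inverse mult.commute)
  have 2: "((\<lambda>y. (f y - f x) * (h' (y - x) / norm (y - x))) \<longlongrightarrow> 0) (at x)"
  proof (rule Lim_null_comparison)
    show "((\<lambda>y. \<bar>f y - f x\<bar> * \<bar>K\<bar>) \<longlongrightarrow> 0) (at x)"
      using f0 by (intro tendsto_mult_left_zero tendsto_rabs_zero)
    have "norm ((f y - f x) * (h' (y - x) / norm (y - x))) \<le> \<bar>f y - f x\<bar> * \<bar>K\<bar>" if "y \<noteq> x" for y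
    proof -
      have "norm (h' (y - x)) \<le> norm (y - x) * \<bar>K\<bar>"
        by (rule order_trans[OF K]) (simp add: mult_left_mono)
      then have "\<bar>h' (y - x)\<bar> / norm (y - x) \<le> \<bar>K\<bar>"
        using that by (simp add: divide_le_eq mult.commute)
      then have "\<bar>f y - f x\<bar> * (\<bar>h' (y - x)\<bar> / norm (y - x)) \<le> \<bar>f y - f x\<bar> * \<bar>K\<bar>"
        by (rule mult_left_mono) simp
      then show ?thesis
        by (simp add: abs_mult)
    qed
    then show "\<forall>\<^sub>F y in at x. norm ((f y - f x) * (h' (y - x) / norm (y - x))) \<le> \<bar>f y - f x\<bar> * \<bar>K\<bar>"
      by (simp add: eventually_at_filter)
  qed
  have "((\<lambda>y. (f y * h y - f x * h x - f x * h' (y - x)) /\<^sub>R norm (y - x)) \<longlongrightarrow> 0) (at x)"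
    using tendsto_add[OF 1 2] h0
    by (simp add: field_simps add_divide_distrib[symmetric] diff_divide_distrib[symmetric])
  then show ?thesis
    unfolding has_derivative_at_within
    using bounded_linear_const_mult[OF bl] by blast
qed

text \<open>The parameter \<open>x\<close> stands for the coordinates in a chart. Smoothness is
  stated for fixed vectors; constancy of the number of distinct eigenvalues is what allows each one
  to be followed as \<open>x\<close> moves.\<close>

locale self_adjoint_family =
  fixes S :: "'a::euclidean_space set"
    and B :: "'a \<Rightarrow> 'b::euclidean_space \<Rightarrow> 'b \<Rightarrow> real" and L :: "'a \<Rightarrow> 'b \<Rightarrow> 'b" and g :: nat
  assumes open_S: "open S" and op: "x \<in> S \<Longrightarrow> self_adjoint_op (B x) (L x)"
    and smooth_B: "smooth_on (\<lambda>x. B x u v) S" and smooth_L: "smooth_on (\<lambda>x. L x u) S"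
    and fin: "x \<in> S \<Longrightarrow> finite (eigenvalues (L x))"
    and card: "x \<in> S \<Longrightarrow> card (eigenvalues (L x)) = g"
begin

text \<open>Passes from fixed vectors to moving ones: the coordinates of \<open>u x\<close> become
  coefficients of the fields \<open>L x b\<close>.\<close>

lemma Ck_L:
  assumes "open U" "U \<subseteq> S" "Ck_on k u U"
  shows "Ck_on k (\<lambda>x. L x (u x)) U"
proof (rule Ck_on_cong_imp[OF assms(1)])
  have "Ck_on k (\<lambda>x. L x b) U" for b
    using smooth_L assms(2) Ck_on_subset unfolding smooth_on_def by blast
  then show "Ck_on k (\<lambda>x. \<Sum>b\<in>Basis. (u x \<bullet> b) *\<^sub>R L x b) U"
    by (intro Ck_on_sum Ck_on_scaleR Ck_on_inner Ck_on_const assms)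
next
  fix x assume "x \<in> U"
  then have l: "linear (L x)" using op assms(2) self_adjoint_op.lin by blast
  show "(\<Sum>b\<in>Basis. (u x \<bullet> b) *\<^sub>R L x b) = L x (u x)"
    using linear_sum[OF l, of "\<lambda>b. (u x \<bullet> b) *\<^sub>R b" Basis]
    by (simp add: linear_scale[OF l] euclidean_representation)
qed

lemma Ck_B:
  assumes "open U" "U \<subseteq> S" "Ck_on k u U" "Ck_on k w U"
  shows "Ck_on k (\<lambda>x. B x (u x) (w x)) U"
proof (rule Ck_on_cong_imp[OF assms(1)])
  have "Ck_on k (\<lambda>x. B x a b) U" for a b
    using smooth_B assms(2) Ck_on_subset unfolding smooth_on_def by blast
  then show "Ck_on k (\<lambda>x. \<Sum>a\<in>Basis. \<Sum>b\<in>Basis. (w x \<bullet> b) * ((u x \<bullet> a) * B x a b)) U"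
    by (intro Ck_on_sum Ck_on_mult Ck_on_inner Ck_on_const assms)
next
  fix x assume "x \<in> U"
  then interpret self_adjoint_op "B x" "L x" using op assms(2) by blast
  have "B x (\<Sum>a\<in>Basis. (u x \<bullet> a) *\<^sub>R a) (\<Sum>b\<in>Basis. (w x \<bullet> b) *\<^sub>R b)
      = (\<Sum>a\<in>Basis. \<Sum>b\<in>Basis. (w x \<bullet> b) * ((u x \<bullet> a) * B x a b))"
    by (simp only: bilinear_sum[OF bilin] sum.cartesian_product[symmetric] bilin_simps real_scaleR_def)
  then show "(\<Sum>a\<in>Basis. \<Sum>b\<in>Basis. (w x \<bullet> b) * ((u x \<bullet> a) * B x a b)) = B x (u x) (w x)"
    by (simp only: euclidean_representation)
qed

lemma Ck_shift_prod:
  assumes "open U" "U \<subseteq> S"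
  shows "(\<And>f. f \<in> set fs \<Longrightarrow> Ck_on k f U) \<Longrightarrow>
    Ck_on k (\<lambda>x. shift_prod (L x) (map (\<lambda>f. f x) fs) v) U"
proof (induction fs)
  case Nil
  show ?case using assms by (simp add: Ck_on_const)
next
  case (Cons f fs)
  then have "Ck_on k (\<lambda>x. shift_prod (L x) (map (\<lambda>f. f x) fs) v) U" "Ck_on k f U" by auto
  then show ?case
    by (simp, intro Ck_on_minus Ck_on_scaleR Ck_L assms)
qed

section \<open>Eigenvalue branches and their regularity\<close>

text \<open>An eigenvector \<open>v\<close> at \<open>x\<close> is an approximate eigenvector at
  nearby \<open>y\<close>. The condition \<open>f y > 0\<close> is the inequality required by
  \<open>near_eigenvalue\<close>; it is open in \<open>y\<close> and holds at \<open>x\<close>,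
  where the residual of \<open>v\<close> vanishes.\<close>

lemma eigenvalue_nearby:
  assumes x: "x \<in> S" and r: "r \<in> eigenvalues (L x)" and \<delta>: "\<delta> > 0"
  obtains W where "open W" "x \<in> W" "W \<subseteq> S"
    "\<And>y. y \<in> W \<Longrightarrow> \<exists>\<mu>\<in>eigenvalues (L y). \<bar>\<mu> - r\<bar> < \<delta>"
proof -
  obtain v where v: "v \<noteq> 0" "L x v = r *\<^sub>R v" using r by (auto simp: eigenvalues_def)
  define f where "f y = \<delta>\<^sup>2 * B y v v - B y (L y v - r *\<^sub>R v) (L y v - r *\<^sub>R v)" for y
  have "Ck_on 0 f S"
    unfolding f_def
    by (intro Ck_on_minus Ck_on_mult Ck_on_const Ck_B Ck_L open_S subset_refl)
  then have "open (S \<inter> f -` {0<..})"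
    using continuous_open_preimage[OF _ open_S open_greaterThan] by simp
  moreover have "x \<in> S \<inter> f -` {0<..}"
  proof -
    interpret self_adjoint_op "B x" "L x" using op x by blast
    show ?thesis using x v \<delta> pos[OF v(1)] by (simp add: f_def bilin_simps)
  qed
  moreover have "\<exists>\<mu>\<in>eigenvalues (L y). \<bar>\<mu> - r\<bar> < \<delta>" if "y \<in> S \<inter> f -` {0<..}" for y
  proof -
    interpret self_adjoint_op "B y" "L y" using op that by blast
    have "B y (L y v - r *\<^sub>R v) (L y v - r *\<^sub>R v) < \<delta>\<^sup>2 * B y v v"
      using that by (simp add: f_def)
    then obtain u \<mu> where "u \<noteq> 0" "L y u = \<mu> *\<^sub>R u" "\<bar>\<mu> - r\<bar> < \<delta>"
      using near_eigenvalue[OF v(1) _ \<delta>] by metis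
    then show ?thesis by (auto simp: eigenvalues_def)
  qed
  ultimately show ?thesis using that by blast
qed

text \<open>Branches are indexed by the eigenvalues at \<open>p\<close>.
  Since the number of distinct eigenvalues is constant, each eigenvalue at \<open>p\<close> has exactly one
  eigenvalue of \<open>L x\<close> in its vicinity.\<close>

lemma continuous_branches:
  assumes p: "p \<in> S"
  obtains U \<rho> where "open U" "p \<in> U" "U \<subseteq> S"
    "\<And>i. i \<in> eigenvalues (L p) \<Longrightarrow> continuous_on U (\<rho> i)"
    "\<And>x. x \<in> U \<Longrightarrow> (\<lambda>i. \<rho> i x) ` eigenvalues (L p) = eigenvalues (L x)"
    "\<And>i. i \<in> eigenvalues (L p) \<Longrightarrow> \<rho> i p = i"
proof -
  let ?\<Sigma> = "eigenvalues (L p)"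
  have "finite ((\<lambda>(i, j). i - j) ` (?\<Sigma> \<times> ?\<Sigma>))" using fin[OF p] by simp
  then obtain d where "d > 0" and d: "\<And>t. t \<in> (\<lambda>(i, j). i - j) ` (?\<Sigma> \<times> ?\<Sigma>) \<Longrightarrow> t \<noteq> 0 \<Longrightarrow> d \<le> dist 0 t"
    using finite_set_avoid by metis
  \<comment> \<open>Here \<open>d\<close> is a lower bound for the gaps between distinct eigenvalues
    at \<open>p\<close>; half of it makes the intervals of radius \<open>\<epsilon>\<close> around
    them disjoint.\<close>
  define \<epsilon> where "\<epsilon> = d / 2"
  have \<epsilon>: "\<epsilon> > 0" using \<open>d > 0\<close> by (simp add: \<epsilon>_def)
  have sep: "i = j" if "i \<in> ?\<Sigma>" "j \<in> ?\<Sigma>" "\<bar>t - i\<bar> < \<epsilon>" "\<bar>t - j\<bar> < \<epsilon>" for i j t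
  proof (rule ccontr)
    assume "i \<noteq> j"
    then have "d \<le> \<bar>i - j\<bar>" using d[of "i - j"] that(1,2) by force
    then show False using that(3,4) unfolding \<epsilon>_def by linarith
  qed
  have "\<forall>i\<in>?\<Sigma>. \<exists>W. open W \<and> p \<in> W \<and> W \<subseteq> S \<and> (\<forall>y\<in>W. \<exists>\<mu>\<in>eigenvalues (L y). \<bar>\<mu> - i\<bar> < \<epsilon>)"
    using eigenvalue_nearby[OF p _ \<epsilon>] by metis
  then obtain W where W: "\<And>i. i \<in> ?\<Sigma> \<Longrightarrow> open (W i) \<and> p \<in> W i \<and>
      (\<forall>y\<in>W i. \<exists>\<mu>\<in>eigenvalues (L y). \<bar>\<mu> - i\<bar> < \<epsilon>)"
    by metis
  define U where "U = S \<inter> (\<Inter>i\<in>?\<Sigma>. W i)"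
  have U: "open U" "p \<in> U" "U \<subseteq> S"
    using W p fin[OF p] open_S by (auto simp: U_def)
  define \<rho> where "\<rho> i x = (SOME \<mu>. \<mu> \<in> eigenvalues (L x) \<and> \<bar>\<mu> - i\<bar> < \<epsilon>)" for i x
  have \<rho>: "\<rho> i x \<in> eigenvalues (L x)" "\<bar>\<rho> i x - i\<bar> < \<epsilon>" if "i \<in> ?\<Sigma>" "x \<in> U" for i x
  proof -
    have "\<exists>\<mu>. \<mu> \<in> eigenvalues (L x) \<and> \<bar>\<mu> - i\<bar> < \<epsilon>" using W[OF that(1)] that by (simp add: U_def) blast
    then have "\<rho> i x \<in> eigenvalues (L x) \<and> \<bar>\<rho> i x - i\<bar> < \<epsilon>"
      unfolding \<rho>_def by (rule someI_ex)
    then show "\<rho> i x \<in> eigenvalues (L x)" "\<bar>\<rho> i x - i\<bar> < \<epsilon>" by auto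
  qed
  have img: "(\<lambda>i. \<rho> i x) ` ?\<Sigma> = eigenvalues (L x)" if x: "x \<in> U" for x
  proof (rule card_subset_eq)
    show "finite (eigenvalues (L x))" using fin x U by blast
    show "(\<lambda>i. \<rho> i x) ` ?\<Sigma> \<subseteq> eigenvalues (L x)" using \<rho> x by blast
    \<comment> \<open>Disjoint intervals make the chosen values distinct. There are as many of them
      as eigenvalues at \<open>p\<close>, hence as many as at \<open>x\<close>, so they exhaust the
      latter.\<close>
    have "inj_on (\<lambda>i. \<rho> i x) ?\<Sigma>"
      using sep \<rho>(2) x by (intro inj_onI) metis
    then show "card ((\<lambda>i. \<rho> i x) ` ?\<Sigma>) = card (eigenvalues (L x))"
      using card U x p by (simp add: card_image subset_iff)
  qed
  have uniq: "\<mu> = \<rho> i x" if "i \<in> ?\<Sigma>" "x \<in> U" "\<mu> \<in> eigenvalues (L x)" "\<bar>\<mu> - i\<bar> < \<epsilon>" for i x \<mu>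
  proof -
    have "\<mu> \<in> (\<lambda>i. \<rho> i x) ` ?\<Sigma>" using that img by simp
    then obtain j where "j \<in> ?\<Sigma>" "\<mu> = \<rho> j x" by blast
    then show ?thesis using sep[of i j \<mu>] \<rho>(2) that by blast
  qed
  have "continuous_on U (\<rho> i)" if i: "i \<in> ?\<Sigma>" for i
  proof (intro continuous_at_imp_continuous_on ballI, unfold isCont_def, rule tendstoI)
    fix x e assume x: "x \<in> U" and e: "e > (0::real)"
    \<comment> \<open>An eigenvalue within \<open>\<delta>\<close> of \<open>\<rho> i x\<close> is
      within \<open>e\<close> of it and also within \<open>\<epsilon>\<close> of \<open>i\<close>;
      by \<open>uniq\<close> it then is \<open>\<rho> i y\<close>.\<close>
    define \<delta> where "\<delta> = min e (\<epsilon> - \<bar>\<rho> i x - i\<bar>)"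
    have "\<delta> > 0" using e \<rho>(2)[OF i x] by (simp add: \<delta>_def)
    then obtain W' where W': "open W'" "x \<in> W'"
        "\<And>y. y \<in> W' \<Longrightarrow> \<exists>\<mu>\<in>eigenvalues (L y). \<bar>\<mu> - \<rho> i x\<bar> < \<delta>"
      using eigenvalue_nearby[OF subsetD[OF U(3) x] \<rho>(1)[OF i x]] by metis
    have "dist (\<rho> i y) (\<rho> i x) < e" if y: "y \<in> U \<inter> W'" for y
    proof -
      obtain \<mu> where \<mu>: "\<mu> \<in> eigenvalues (L y)" "\<bar>\<mu> - \<rho> i x\<bar> < \<delta>" using W' y by blast
      then have "\<bar>\<mu> - i\<bar> < \<epsilon>" by (auto simp: \<delta>_def)
      then have "\<mu> = \<rho> i y" using uniq i y \<mu>(1) by blast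
      then show ?thesis using \<mu>(2) by (simp add: \<delta>_def dist_real_def)
    qed
    then show "\<forall>\<^sub>F y in at x. dist (\<rho> i y) (\<rho> i x) < e"
      using W' U x by (auto simp: eventually_at_topological intro!: exI[of _ "U \<inter> W'"])
  qed
  moreover have "\<rho> i p = i" if "i \<in> ?\<Sigma>" for i
    using uniq[OF that U(2), of i] that \<epsilon> by simp
  ultimately show ?thesis using that U img by metis
qed

text \<open>Self-adjointness of \<open>L x\<close> gives
  \<open>(\<rho> y - \<rho> x) * B x (q x) (q y) = B x (q x) (L y (q y) - L x (q y))\<close>; hence mere continuity of the
  eigenvector field \<open>q\<close> makes the eigenvalue differentiable.\<close>

lemma eigenvalue_has_derivative:
  assumes U: "open U" "U \<subseteq> S" and q: "continuous_on U q" and x: "x \<in> U"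
    and eig: "\<And>y. y \<in> U \<Longrightarrow> L y (q y) = \<rho> y *\<^sub>R q y" and nz: "q x \<noteq> 0"
  shows "(\<rho> has_derivative (\<lambda>v. \<Sum>b\<in>Basis. (q x \<bullet> b) * inverse (B x (q x) (q x)) *
    B x (q x) (frechet_derivative (\<lambda>y. L y b) (at x) v))) (at x)"
proof -
  interpret self_adjoint_op "B x" "L x" using op x U by blast
  have xS: "x \<in> S" using x U by blast
  have bl: "bounded_linear (B x w)" for w
    using bilin by (simp add: bilinear_def linear_conv_bounded_linear)
  have cq: "isCont q x" using q U(1) x continuous_on_eq_continuous_at by blast
  define \<phi> where "\<phi> y = B x (q x) (q y)" for y
  have c\<phi>: "isCont \<phi> x"
    unfolding \<phi>_def by (rule isCont_o2[OF cq linear_continuous_at[OF bl]])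
  have \<phi>x: "\<phi> x > 0" using pos[OF nz] by (simp add: \<phi>_def)
  have "continuous_on U \<phi>"
    unfolding \<phi>_def using continuous_on_compose2[OF linear_continuous_on[OF bl] q, of UNIV] by simp
  then have opn: "open (U \<inter> \<phi> -` {0<..})"
    using continuous_open_preimage[OF _ U(1) open_greaterThan] by simp
  \<comment> \<open>The increment of \<open>L\<close> on a fixed vector, paired with
    \<open>q x\<close>. It vanishes at \<open>y = x\<close>, so the product rule with a merely
    continuous factor applies; \<open>q y\<close> enters only through its coordinates and
    \<open>\<phi> y\<close>.\<close>
  define h where "h b y = B x (q x) (L y b - L x b)" for b y
  have hd: "(h b has_derivative (\<lambda>v. B x (q x) (frechet_derivative (\<lambda>y. L y b) (at x) v))) (at x)" for b
  proof -
    have "((\<lambda>y. L y b - L x b) has_derivative frechet_derivative (\<lambda>y. L y b) (at x)) (at x)"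
      using has_derivative_diff[OF smooth_on_has_derivative[OF smooth_L xS] has_derivative_const] by simp
    then show ?thesis
      unfolding h_def by (rule bounded_linear.has_derivative[OF bl])
  qed
  have "((\<lambda>y. ((q y \<bullet> b) * inverse (\<phi> y)) * h b y) has_derivative (\<lambda>v. (q x \<bullet> b) * inverse (\<phi> x) *
      B x (q x) (frechet_derivative (\<lambda>y. L y b) (at x) v))) (at x)" for b
    using cq c\<phi> \<phi>x
    by (intro has_derivative_mult_vanishing[OF _ hd]) (auto simp: h_def bilin_simps intro!: continuous_intros)
  then have "((\<lambda>y. \<rho> x + (\<Sum>b\<in>Basis. ((q y \<bullet> b) * inverse (\<phi> y)) * h b y)) has_derivative
      (\<lambda>v. 0 + (\<Sum>b\<in>Basis. (q x \<bullet> b) * inverse (\<phi> x) *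
      B x (q x) (frechet_derivative (\<lambda>y. L y b) (at x) v)))) (at x)"
    by (intro has_derivative_add has_derivative_const has_derivative_sum)
  then have "(\<rho> has_derivative (\<lambda>v. 0 + (\<Sum>b\<in>Basis. (q x \<bullet> b) * inverse (\<phi> x) *
      B x (q x) (frechet_derivative (\<lambda>y. L y b) (at x) v)))) (at x)"
  proof (rule has_derivative_transform_within_open[OF _ opn])
    show "x \<in> U \<inter> \<phi> -` {0<..}" using x \<phi>x by simp
    fix y assume "y \<in> U \<inter> \<phi> -` {0<..}"
    then have y: "y \<in> U" "\<phi> y > 0" by auto
    have ly: "linear (L y)" using op y(1) U self_adjoint_op.lin by blast
    have rep: "M (q y) = (\<Sum>b\<in>Basis. (q y \<bullet> b) *\<^sub>R M b)" if "linear M" for M :: "'b \<Rightarrow> real"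
      using linear_sum[OF that, of "\<lambda>b. (q y \<bullet> b) *\<^sub>R b" Basis]
      by (simp add: linear_scale[OF that] euclidean_representation)
    have "(\<rho> y - \<rho> x) * \<phi> y = B x (q x) (L y (q y) - L x (q y))"
      using eig[OF y(1)] eig[OF x] adj[of "q x" "q y"]
      by (simp add: \<phi>_def bilin_simps algebra_simps)
    also have "\<dots> = (\<Sum>b\<in>Basis. (q y \<bullet> b) *\<^sub>R h b y)"
      unfolding h_def
      by (rule rep) (auto simp: linear_iff linear_add[OF ly] linear_scale[OF ly] linear_add[OF lin]
          linear_scale[OF lin] bilin_simps algebra_simps)
    finally have "\<rho> y - \<rho> x = inverse (\<phi> y) * (\<Sum>b\<in>Basis. (q y \<bullet> b) *\<^sub>R h b y)"
      using y(2) by (simp add: field_simps)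
    then show "\<rho> x + (\<Sum>b\<in>Basis. ((q y \<bullet> b) * inverse (\<phi> y)) * h b y) = \<rho> y"
      by (simp add: sum_distrib_left mult_ac)
  qed
  then show ?thesis by (simp add: \<phi>_def)
qed

text \<open>The formula for the derivative of \<open>\<rho>\<close> involves \<open>q\<close> but no
  derivative of \<open>q\<close>, so the eigenvalue gains one order of regularity over the
  eigenvector field.\<close>

lemma Ck_eigenvalue_Suc:
  assumes U: "open U" "U \<subseteq> S" and q: "Ck_on k q U"
    and eig: "\<And>y. y \<in> U \<Longrightarrow> L y (q y) = \<rho> y *\<^sub>R q y" and nz: "\<And>y. y \<in> U \<Longrightarrow> q y \<noteq> 0"
  shows "Ck_on (Suc k) \<rho> U"
proof (rule Ck_on_SucI[OF U(1)])
  have "Ck_on 0 q U" using q by (induction k) (auto dest: Ck_on_SucD simp del: Ck_on.simps)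
  then show "(\<rho> has_derivative (\<lambda>v. \<Sum>b\<in>Basis. (q x \<bullet> b) * inverse (B x (q x) (q x)) *
      B x (q x) (frechet_derivative (\<lambda>y. L y b) (at x) v))) (at x)" if "x \<in> U" for x
    using eigenvalue_has_derivative[OF U _ that] eig nz that by simp
  fix v
  have 1: "Ck_on k (\<lambda>x. frechet_derivative (\<lambda>y. L y b) (at x) v) U" for b
    using smooth_on_frechet_derivative[OF smooth_L] Ck_on_subset[OF _ U(2)] smooth_on_def by blast
  have 2: "B x (q x) (q x) \<noteq> 0" if "x \<in> U" for x
    using nz[OF that] self_adjoint_op.eq_0_iff[OF op] that U by blast
  show "Ck_on k (\<lambda>x. \<Sum>b\<in>Basis. (q x \<bullet> b) * inverse (B x (q x) (q x)) *
      B x (q x) (frechet_derivative (\<lambda>y. L y b) (at x) v)) U"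
    by (intro Ck_on_sum Ck_on_mult Ck_on_inverse Ck_B Ck_on_inner Ck_on_const U q 1 2)
qed

text \<open>If \<open>\<rho> j\<close> are the eigenvalue branches, then \<open>\<Prod>j\<noteq>i. (L x - \<rho> j x)\<close> maps every vector into the
  eigenspace of \<open>\<rho> i x\<close>, and is a nonzero scalar on that of \<open>i\<close> at \<open>p\<close>. Smoothness of the branches is
  bootstrapped: \<open>C\<^sup>k\<close> branches give \<open>C\<^sup>k\<close> eigenvector fields, and these give \<open>C\<^sup>k\<^sup>+\<^sup>1\<close> branches.\<close>

lemma extend_eigenvector:
  assumes p: "p \<in> S" and w: "w \<noteq> 0" "L p w = r *\<^sub>R w"
  obtains U Y \<mu> c where "open U" "p \<in> U" "U \<subseteq> S" "smooth_on Y U"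
    "\<And>x. x \<in> U \<Longrightarrow> L x (Y x) = \<mu> x *\<^sub>R Y x" "Y p = c *\<^sub>R w" "c \<noteq> 0"
proof -
  let ?\<Sigma> = "eigenvalues (L p)"
  obtain U \<rho> where U: "open U" "p \<in> U" "U \<subseteq> S"
    and cont: "\<And>i. i \<in> ?\<Sigma> \<Longrightarrow> continuous_on U (\<rho> i)"
    and img: "\<And>x. x \<in> U \<Longrightarrow> (\<lambda>i. \<rho> i x) ` ?\<Sigma> = eigenvalues (L x)"
    and \<rho>p: "\<And>i. i \<in> ?\<Sigma> \<Longrightarrow> \<rho> i p = i"
    using continuous_branches[OF p] by metis
  \<comment> \<open>Branches are labelled by their values at \<open>p\<close>, so this lists the
    labels of all branches other than \<open>i\<close>.\<close>
  define js where "js i = sorted_list_of_set (?\<Sigma> - {i})" for i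
  have js: "set (js i) = ?\<Sigma> - {i}" for i
    using fin[OF p] by (simp add: js_def)
  define Q where "Q i v x = shift_prod (L x) (map (\<lambda>f. f x) (map \<rho> (js i))) v" for i v x
  have Ck_Q: "Ck_on k (Q i v) V" if "open V" "V \<subseteq> U" "\<And>j. j \<in> ?\<Sigma> \<Longrightarrow> Ck_on k (\<rho> j) V" for i v k V
    unfolding Q_def using that U js by (intro Ck_shift_prod) auto
  have eig: "L x (Q i v x) = \<rho> i x *\<^sub>R Q i v x" if i: "i \<in> ?\<Sigma>" and x: "x \<in> U" for i v x
  proof -
    interpret self_adjoint_op "B x" "L x" using op x U by blast
    \<comment> \<open>With \<open>\<rho> i x\<close> added the list contains every eigenvalue of
      \<open>L x\<close>, so the product vanishes. Its outermost factor is
      \<open>L x - \<rho> i x\<close>, which gives the eigenvector equation.\<close>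
    have "shift_prod (L x) (\<rho> i x # map (\<lambda>f. f x) (map \<rho> (js i))) v = 0"
    proof (rule shift_prod_eq_0)
      fix \<mu> v assume "v \<noteq> 0" "L x v = \<mu> *\<^sub>R v"
      then have "\<mu> \<in> (\<lambda>i. \<rho> i x) ` ?\<Sigma>" using img[OF x] by (auto simp: eigenvalues_def)
      then show "\<mu> \<in> set (\<rho> i x # map (\<lambda>f. f x) (map \<rho> (js i)))"
        using i by (auto simp: js)
    qed
    then show ?thesis by (simp add: Q_def)
  qed
  have Qp: "\<exists>c. c \<noteq> 0 \<and> Q i v p = c *\<^sub>R v" if i: "L p v = i *\<^sub>R v" for i v
  proof -
    have l: "linear (L p)" using op p self_adjoint_op.lin by blast
    have m: "map (\<lambda>f. f p) (map \<rho> (js i)) = js i"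
      unfolding map_map by (rule map_idI) (simp add: js \<rho>p)
    have "Q i v p = (\<Prod>r\<leftarrow>js i. i - r) *\<^sub>R v"
      unfolding Q_def m by (rule shift_prod_eigen[OF l i])
    moreover have "(\<Prod>r\<leftarrow>js i. i - r) \<noteq> 0"
      using js by (auto simp: prod_list_zero_iff)
    ultimately show ?thesis by blast
  qed
  have "\<forall>i\<in>?\<Sigma>. \<exists>v. v \<noteq> 0 \<and> L p v = i *\<^sub>R v" by (simp add: eigenvalues_def)
  then obtain v where v: "\<And>i. i \<in> ?\<Sigma> \<Longrightarrow> v i \<noteq> 0 \<and> L p (v i) = i *\<^sub>R v i" by metis
  \<comment> \<open>One neighbourhood on which the fields of all branches are nonzero: each field is
    built from the other branches, so the induction on \<open>k\<close> must treat all branches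
    together.\<close>
  define V where "V = U \<inter> (\<Inter>i\<in>?\<Sigma>. U \<inter> Q i (v i) -` (- {0}))"
  have cQ: "continuous_on U (Q i (v i))" for i
    using Ck_Q[OF U(1) subset_refl, of 0] cont by simp
  have "open (U \<inter> Q i (v i) -` (- {0}))" for i
    by (rule continuous_open_preimage[OF cQ U(1)]) auto
  then have "open V"
    unfolding V_def using fin[OF p] U(1) by (intro open_Int open_INT) auto
  then have V: "open V" "V \<subseteq> U" "V \<subseteq> S"
    using U(3) by (auto simp: V_def)
  have pV: "p \<in> V"
  proof -
    have "Q i (v i) p \<noteq> 0" if "i \<in> ?\<Sigma>" for i
      using Qp[of "v i" i] v[OF that] by auto
    then show ?thesis using U(2) by (auto simp: V_def)
  qed
  have smooth: "Ck_on k (\<rho> i) V" if "i \<in> ?\<Sigma>" for i k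
    using that
  proof (induction k arbitrary: i)
    case 0
    then show ?case using cont continuous_on_subset V by auto
  next
    case (Suc k)
    show ?case
      by (rule Ck_eigenvalue_Suc[OF V(1,3) Ck_Q[where i = i and v = "v i", OF V(1,2) Suc.IH]
              eig[OF Suc.prems]]) (use V(2) Suc.prems in \<open>auto simp: V_def split: if_splits\<close>)
  qed
  have r: "r \<in> ?\<Sigma>" using w by (auto simp: eigenvalues_def)
  obtain c where c: "c \<noteq> 0" "Q r w p = c *\<^sub>R w" using Qp[OF w(2)] by blast
  have "smooth_on (Q r w) V"
    unfolding smooth_on_def using Ck_Q[OF V(1,2) smooth] by blast
  then show ?thesis
    using that[of V "Q r w" "\<rho> r" c] V pV eig[OF r] c by blast
qed

text \<open>Gram--Schmidt preserves eigenvectors: a new eigenvector field is projected only along those old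
  fields to which it is not orthogonal, and these belong to the same eigenvalue.\<close>

lemma orthonormal_eigenvector_fields:
  assumes p: "p \<in> S"
  shows "k \<le> DIM('b) \<Longrightarrow> \<exists>U \<xi>. open U \<and> p \<in> U \<and> U \<subseteq> S \<and> (\<forall>i<k. smooth_on (\<xi> i) U) \<and>
    (\<forall>x\<in>U. self_adjoint_op.orthonormal (B x) k (\<lambda>i. \<xi> i x) \<and>
      (\<forall>i<k. \<exists>\<mu>. L x (\<xi> i x) = \<mu> *\<^sub>R \<xi> i x))"
proof (induction k)
  case 0
  have "self_adjoint_op.orthonormal (B x) 0 \<xi>" if "x \<in> S" for x \<xi>
    using self_adjoint_op.orthonormal_def[OF op[OF that]] by simp
  then show ?case using p open_S by (intro exI[of _ S]) auto
next
  case (Suc k)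
  then obtain U \<xi> where U: "open U" "p \<in> U" "U \<subseteq> S" and sm: "\<And>i. i < k \<Longrightarrow> smooth_on (\<xi> i) U"
    and on: "\<And>x. x \<in> U \<Longrightarrow> self_adjoint_op.orthonormal (B x) k (\<lambda>i. \<xi> i x)"
    and eig: "\<And>x i. x \<in> U \<Longrightarrow> i < k \<Longrightarrow> \<exists>\<mu>. L x (\<xi> i x) = \<mu> *\<^sub>R \<xi> i x"
    by (metis Suc_leD)
  interpret P: self_adjoint_op "B p" "L p" using op p by blast
  obtain w r where w: "w \<noteq> 0" "L p w = r *\<^sub>R w" "\<And>i. i < k \<Longrightarrow> B p w (\<xi> i p) = 0"
    using P.next_eigenvector[OF on[OF U(2)]] eig[OF U(2)] Suc.prems by (metis Suc_le_lessD)
  obtain V Y \<mu> c where V: "open V" "p \<in> V" "V \<subseteq> S" and Y: "smooth_on Y V"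
    and Ye: "\<And>x. x \<in> V \<Longrightarrow> L x (Y x) = \<mu> x *\<^sub>R Y x" and c: "Y p = c *\<^sub>R w" "c \<noteq> 0"
    using extend_eigenvector[OF p w(1,2)] by metis
  define Z where "Z x = Y x - (\<Sum>i<k. B x (Y x) (\<xi> i x) *\<^sub>R \<xi> i x)" for x
  let ?W = "U \<inter> V"
  have W: "open ?W" "?W \<subseteq> S" using U V by auto
  have Ck\<xi>: "Ck_on n (\<xi> i) ?W" if "i < k" for i n
    using sm[OF that] Ck_on_subset smooth_on_def by blast
  have CkY: "Ck_on n Y ?W" for n
    using Y Ck_on_subset smooth_on_def by blast
  have CkZ: "Ck_on n Z ?W" for n
    unfolding Z_def using Ck\<xi> by (intro Ck_on_minus Ck_on_sum Ck_on_scaleR Ck_B CkY W) auto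
  have Ck_BZ: "Ck_on n (\<lambda>x. B x (Z x) (Z x)) ?W" for n
    by (intro Ck_B W CkZ)
  define N where "N = ?W \<inter> (\<lambda>x. B x (Z x) (Z x)) -` {0<..}"
  have "continuous_on ?W (\<lambda>x. B x (Z x) (Z x))" using Ck_BZ[of 0] by simp
  then have N: "open N" "N \<subseteq> ?W" unfolding N_def
    using continuous_open_preimage[OF _ W(1) open_greaterThan] by auto
  \<comment> \<open>At \<open>p\<close> the vector \<open>w\<close> is orthogonal to the earlier
    fields, so the projection subtracts nothing. Hence \<open>Z\<close> is nonzero at
    \<open>p\<close> and can be normalized nearby.\<close>
  have "Z p = c *\<^sub>R w" using w(3) c by (simp add: Z_def P.bilin_simps)
  then have "p \<in> N" using P.pos[of "Z p"] c w U V by (simp add: N_def)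
  define \<zeta> where "\<zeta> x = inverse (sqrt (B x (Z x) (Z x))) *\<^sub>R Z x" for x
  have "Ck_on n \<zeta> N" for n
    unfolding \<zeta>_def
    using N Ck_on_subset[OF CkZ N(2)] Ck_on_subset[OF Ck_BZ N(2)]
    by (intro Ck_on_scaleR Ck_on_rsqrt) (auto simp: N_def)
  then have "smooth_on \<zeta> N" by (simp add: smooth_on_def)
  have main: "self_adjoint_op.orthonormal (B x) (Suc k) (\<lambda>i. (\<xi>(k := \<zeta>)) i x) \<and>
      (\<exists>\<mu>. L x (\<zeta> x) = \<mu> *\<^sub>R \<zeta> x)" if x: "x \<in> N" for x
  proof -
    have xU: "x \<in> U" and xV: "x \<in> V" and xS: "x \<in> S" and BZ: "B x (Z x) (Z x) > 0"
      using x N U by (auto simp: N_def)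
    interpret self_adjoint_op "B x" "L x" using op xS by blast
    have on': "B x (\<xi> i x) (\<xi> j x) = (if i = j then 1 else 0)" if "i < k" "j < k" for i j
      using on[OF xU] that by (simp add: orthonormal_def)
    have term_eig: "L x (B x (Y x) (\<xi> i x) *\<^sub>R \<xi> i x) = \<mu> x *\<^sub>R (B x (Y x) (\<xi> i x) *\<^sub>R \<xi> i x)"
      if i: "i < k" for i
    proof -
      obtain \<nu> where \<nu>: "L x (\<xi> i x) = \<nu> *\<^sub>R \<xi> i x" using eig[OF xU i] by blast
      then show ?thesis
        using eigenvectors_orthogonal[OF Ye[OF xV] \<nu>]
        by (cases "\<mu> x = \<nu>") (simp_all add: linear_scale[OF lin] linear_0[OF lin])
    qed
    have "L x (Z x) = \<mu> x *\<^sub>R Z x"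
      unfolding Z_def linear_diff[OF lin] linear_sum[OF lin] scaleR_diff_right scaleR_sum_right
      using term_eig Ye[OF xV] by (intro arg_cong2[of _ _ _ _ "(-)"] sum.cong) auto
    then have e: "L x (\<zeta> x) = \<mu> x *\<^sub>R \<zeta> x"
      by (simp add: \<zeta>_def linear_scale[OF lin])
    have "B x (Z x) (\<xi> j x) = 0" if j: "j < k" for j
    proof -
      have l: "linear (\<lambda>w. B x w (\<xi> j x))" using bilin by (simp add: bilinear_def)
      have "B x (\<Sum>i<k. B x (Y x) (\<xi> i x) *\<^sub>R \<xi> i x) (\<xi> j x) = (\<Sum>i<k. if j = i then B x (Y x) (\<xi> i x) else 0)"
        unfolding linear_sum[OF l]
        using on' j by (intro sum.cong) (auto simp: bilin_simps)
      then show ?thesis using j by (simp add: Z_def bilin_simps)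
    qed
    then have o1: "B x (\<zeta> x) (\<xi> j x) = 0" if "j < k" for j
      using that by (simp add: \<zeta>_def bilin_simps)
    then have o2: "B x (\<xi> j x) (\<zeta> x) = 0" if "j < k" for j
      using that sym by metis
    have "B x (\<zeta> x) (\<zeta> x) = 1"
      using BZ by (simp add: \<zeta>_def bilin_simps field_simps)
    then show ?thesis
      using e o1 o2 on' by (auto simp: orthonormal_def less_Suc_eq)
  qed
  show ?case
  proof (intro exI[of _ N] exI[of _ "\<xi>(k := \<zeta>)"] conjI allI impI ballI)
    show "smooth_on ((\<xi>(k := \<zeta>)) i) N" if "i < Suc k" for i
      using that sm smooth_on_subset \<open>smooth_on \<zeta> N\<close> N by (auto simp: less_Suc_eq)
    show "\<exists>\<mu>. L x ((\<xi>(k := \<zeta>)) i x) = \<mu> *\<^sub>R (\<xi>(k := \<zeta>)) i x" if "x \<in> N" "i < Suc k" for x i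
      using main[OF that(1)] eig that N by (auto simp: less_Suc_eq)
  qed (use N U main \<open>p \<in> N\<close> in auto)
qed

end

section \<open>Tangent vectors in a chart\<close>

text \<open>The inverse of reading a tangent vector in the chart \<open>c\<close>; it identifies
  \<open>real ^ 'n\<close> with the tangent space at \<open>q\<close>. The value 0 elsewhere matches
  the convention in \<open>tangent_space\<close>.\<close>

definition tangent_lift ::
  "('a, 'n::finite) chart set \<Rightarrow> ('a, 'n) chart \<Rightarrow> 'a \<Rightarrow> real ^ 'n \<Rightarrow> ('a, 'n) tvec" where
  "tangent_lift \<A> c q a = (\<lambda>d. if d \<in> \<A> \<and> q \<in> chart_dom d then transition_deriv c d q a else 0)"

lemma coord_vec_eq_lift: "coord_vec \<A> c i q = tangent_lift \<A> c q (axis i 1)"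
  by (simp add: coord_vec_def tangent_lift_def)

locale smooth_atlas =
  fixes M :: "'a topology" and \<A> :: "('a, 'n::finite) chart set"
  assumes manifold: "smooth_manifold M \<A>"
begin

lemma chart:
  assumes "c \<in> \<A>"
  shows "openin M (chart_dom c)" "open (chart_map c ` chart_dom c)"
    "homeomorphic_map (subtopology M (chart_dom c))
      (top_of_set (chart_map c ` chart_dom c)) (chart_map c)"
  using manifold assms by (auto simp: smooth_manifold_def is_chart_def)

lemma chart_topspace: "c \<in> \<A> \<Longrightarrow> topspace (subtopology M (chart_dom c)) = chart_dom c"
  using openin_subset[OF chart(1), of c] by (simp add: inf.absorb2)

lemma inj_on_chart_map: "c \<in> \<A> \<Longrightarrow> inj_on (chart_map c) (chart_dom c)"
  using homeomorphic_imp_injective_map[OF chart(3)] chart_topspace by metis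

lemma chart_inv_chart_map: "c \<in> \<A> \<Longrightarrow> q \<in> chart_dom c \<Longrightarrow> chart_inv c (chart_map c q) = q"
  by (simp add: chart_inv_def inv_into_f_f inj_on_chart_map)

lemma open_chart_image:
  assumes "c \<in> \<A>" "openin M V" "V \<subseteq> chart_dom c"
  shows "open (chart_map c ` V)"
proof -
  have "openin (subtopology M (chart_dom c)) V"
    using assms chart(1) by (simp add: openin_open_subtopology)
  then have "openin (top_of_set (chart_map c ` chart_dom c)) (chart_map c ` V)"
    using homeomorphic_imp_open_map[OF chart(3)[OF assms(1)]] by (simp add: open_map_def)
  then show ?thesis
    using openin_open_eq[OF chart(2)[OF assms(1)]] by blast
qed

lemma openin_chart_preimage:
  assumes "c \<in> \<A>" "open T"
  shows "openin M {q \<in> chart_dom c. chart_map c q \<in> T}"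
proof -
  have "continuous_map (subtopology M (chart_dom c)) (top_of_set (chart_map c ` chart_dom c)) (chart_map c)"
    using homeomorphic_imp_continuous_map[OF chart(3)[OF assms(1)]] .
  then have "continuous_map (subtopology M (chart_dom c)) euclidean (chart_map c)"
    by (simp add: continuous_map_in_subtopology)
  then have "openin (subtopology M (chart_dom c)) {q \<in> chart_dom c. chart_map c q \<in> T}"
    using openin_continuous_map_preimage[of _ _ _ T] assms chart_topspace[OF assms(1)] by fastforce
  then show ?thesis
    using openin_open_subtopology chart(1)[OF assms(1)] by blast
qed

lemma openin_Int_chart_dom: "c \<in> \<A> \<Longrightarrow> openin M V \<Longrightarrow> openin M (V \<inter> chart_dom c)"
  using chart(1) by blast

lemma transition_chart_map:
  "c \<in> \<A> \<Longrightarrow> q \<in> chart_dom c \<Longrightarrow> transition c d (chart_map c q) = chart_map d q"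
  by (simp add: transition_def chart_inv_chart_map)

lemma smooth_transition:
  "c \<in> \<A> \<Longrightarrow> d \<in> \<A> \<Longrightarrow>
    smooth_on (transition c d) (chart_map c ` (chart_dom c \<inter> chart_dom d))"
  using manifold by (auto simp: smooth_manifold_def compatible_def)

lemma transition_has_derivative:
  assumes "c \<in> \<A>" "d \<in> \<A>" "q \<in> chart_dom c" "q \<in> chart_dom d"
  shows "(transition c d has_derivative transition_deriv c d q) (at (chart_map c q))"
  unfolding transition_deriv_def
  using smooth_on_has_derivative[OF smooth_transition[OF assms(1,2)]] assms(3,4) by blast

lemmas linear_transition_deriv = transition_has_derivative[THEN has_derivative_linear]

text \<open>Chain rule for the change from \<open>c\<close> through \<open>d\<close> to
  \<open>e\<close>. The composite agrees with the direct change on the image of the triple overlap,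
  an open neighbourhood of the coordinates of \<open>q\<close>.\<close>

lemma transition_deriv_cocycle:
  assumes c: "c \<in> \<A>" "q \<in> chart_dom c" and d: "d \<in> \<A>" "q \<in> chart_dom d"
    and e: "e \<in> \<A>" "q \<in> chart_dom e"
  shows "transition_deriv c e q v = transition_deriv d e q (transition_deriv c d q v)"
proof -
  let ?V = "chart_dom c \<inter> chart_dom d \<inter> chart_dom e"
  have eq: "transition c d (chart_map c q) = chart_map d q"
    using c by (rule transition_chart_map)
  have "((transition d e \<circ> transition c d) has_derivative
      (transition_deriv d e q \<circ> transition_deriv c d q)) (at (chart_map c q))"
    by (rule diff_chain_at) (simp_all add: eq transition_has_derivative c d e)
  moreover have "open (chart_map c ` ?V)"
    by (intro open_chart_image openin_Int chart(1) c d e) auto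
  ultimately have "(transition c e has_derivative
      (transition_deriv d e q \<circ> transition_deriv c d q)) (at (chart_map c q))"
    by (rule has_derivative_transform_within_open) (use c d e in \<open>auto simp: transition_chart_map\<close>)
  then have "transition_deriv d e q \<circ> transition_deriv c d q = transition_deriv c e q"
    using transition_has_derivative[OF c(1) e(1) c(2) e(2)] has_derivative_unique by blast
  then show ?thesis by (auto simp: fun_eq_iff)
qed

lemma transition_deriv_self:
  assumes c: "c \<in> \<A>" "q \<in> chart_dom c"
  shows "transition_deriv c c q v = v"
proof -
  have "((\<lambda>x. x) has_derivative (\<lambda>x. x)) (at (chart_map c q))" by (rule has_derivative_ident)
  then have "(transition c c has_derivative (\<lambda>x. x)) (at (chart_map c q))"
    by (rule has_derivative_transform_within_open[OF _ chart(2)[OF c(1)]])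
      (use c in \<open>auto simp: transition_chart_map\<close>)
  then show ?thesis
    using transition_has_derivative[OF c(1) c(1) c(2) c(2)] has_derivative_unique by metis
qed

context
  fixes c q assumes c: "c \<in> \<A>" and q: "q \<in> chart_dom c"
begin

lemma tangent_lift_in_tangent_space: "tangent_lift \<A> c q a \<in> tangent_space \<A> q"
  unfolding tangent_space_def mem_Collect_eq
proof (intro conjI allI impI ballI)
  fix d e assume "d \<in> \<A>" "e \<in> \<A>" "q \<in> chart_dom d \<inter> chart_dom e"
  then show "tangent_lift \<A> c q a e = transition_deriv d e q (tangent_lift \<A> c q a d)"
    using transition_deriv_cocycle[OF c q, of d e a] by (simp add: tangent_lift_def)
qed (auto simp: tangent_lift_def)

lemma tangent_lift_apply: "tangent_lift \<A> c q a c = a"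
  using c q by (simp add: tangent_lift_def transition_deriv_self)

lemma tangent_lift_of_tangent:
  assumes "v \<in> tangent_space \<A> q"
  shows "tangent_lift \<A> c q (v c) = v"
proof
  fix d
  show "tangent_lift \<A> c q (v c) d = v d"
  proof (cases "d \<in> \<A> \<and> q \<in> chart_dom d")
    case True
    then have "v d = transition_deriv c d q (v c)"
      using assms c q unfolding tangent_space_def by blast
    then show ?thesis using True by (simp add: tangent_lift_def)
  next
    case False
    then have "v d = 0" using assms unfolding tangent_space_def by blast
    then show ?thesis using False by (auto simp: tangent_lift_def)
  qed
qed

lemma linear_tangent_lift: "linear (tangent_lift \<A> c q)"
  using linear_transition_deriv[OF c _ q]
  by (intro linearI)
    (auto simp: tangent_lift_def fun_eq_iff plus_fun_def scaleR_fun_def linear_add linear_scale)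

lemma inj_tangent_lift: "inj (tangent_lift \<A> c q)"
  using tangent_lift_apply by (metis injI)

lemma range_tangent_lift: "range (tangent_lift \<A> c q) = tangent_space \<A> q"
proof (intro equalityI subsetI)
  fix v assume "v \<in> tangent_space \<A> q"
  then have "v = tangent_lift \<A> c q (v c)" by (rule tangent_lift_of_tangent[symmetric])
  then show "v \<in> range (tangent_lift \<A> c q)" by (rule range_eqI)
qed (use tangent_lift_in_tangent_space in blast)

end

text \<open>In another chart \<open>d\<close> the field is \<open>F\<close> composed with the change
  from \<open>d\<close> to \<open>c\<close>, where \<open>F\<close> applies the differential of the
  change from \<open>c\<close> to \<open>d\<close> to \<open>\<eta>\<close>. Both are smooth on the
  overlap.\<close>

lemma smooth_vector_field_lift:
  assumes c: "c \<in> \<A>" and T: "open T" "T \<subseteq> chart_map c ` chart_dom c" and \<eta>: "smooth_on \<eta> T"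
  shows "smooth_vector_field_on \<A> {q \<in> chart_dom c. chart_map c q \<in> T}
    (\<lambda>q. tangent_lift \<A> c q (\<eta> (chart_map c q)))"
  unfolding smooth_vector_field_on_def
proof (intro conjI ballI)
  let ?U = "{q \<in> chart_dom c. chart_map c q \<in> T}"
  fix d assume d: "d \<in> \<A>"
  let ?V = "?U \<inter> chart_dom d"
  define F where "F z = frechet_derivative (transition c d) (at z) (\<eta> z)" for z
  have V: "openin M ?V"
    using openin_chart_preimage[OF c T(1)] d by (rule openin_Int_chart_dom[rotated])
  have oc: "open (chart_map c ` ?V)" and od: "open (chart_map d ` ?V)"
    using open_chart_image[OF c V] open_chart_image[OF d V] by auto
  have sub: "chart_map c ` ?V \<subseteq> chart_map c ` (chart_dom c \<inter> chart_dom d)" "chart_map c ` ?V \<subseteq> T"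
    "chart_map d ` ?V \<subseteq> chart_map d ` (chart_dom d \<inter> chart_dom c)" by auto
  have sc: "smooth_on (transition c d) (chart_map c ` ?V)"
    using smooth_transition[OF c d] sub(1) by (rule smooth_on_subset)
  have F: "Ck_on k F (chart_map c ` ?V)" for k
  proof (rule Ck_on_cong_imp[OF oc])
    have "Ck_on k \<eta> (chart_map c ` ?V)"
      using \<eta> sub(2) Ck_on_subset unfolding smooth_on_def by blast
    moreover have "Ck_on k (\<lambda>z. frechet_derivative (transition c d) (at z) b) (chart_map c ` ?V)" for b
      using smooth_on_frechet_derivative[OF sc] unfolding smooth_on_def by blast
    ultimately show "Ck_on k (\<lambda>z. \<Sum>b\<in>Basis. (\<eta> z \<bullet> b) *\<^sub>R frechet_derivative (transition c d) (at z) b)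
        (chart_map c ` ?V)"
      by (intro Ck_on_sum Ck_on_scaleR Ck_on_inner Ck_on_const oc)
  next
    fix z assume "z \<in> chart_map c ` ?V"
    then have l: "linear (frechet_derivative (transition c d) (at z))"
      using smooth_on_has_derivative[OF sc] has_derivative_linear by blast
    show "(\<Sum>b\<in>Basis. (\<eta> z \<bullet> b) *\<^sub>R frechet_derivative (transition c d) (at z) b) = F z"
      using linear_sum[OF l, of "\<lambda>b. (\<eta> z \<bullet> b) *\<^sub>R b" Basis]
      by (simp add: F_def linear_scale[OF l] euclidean_representation)
  qed
  have comp: "Ck_on k (\<lambda>y. F (transition d c y)) (chart_map d ` ?V)" for k
  proof (rule Ck_on_compose[OF od oc _ F])
    show "transition d c ` chart_map d ` ?V \<subseteq> chart_map c ` ?V"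
      using d by (auto simp: transition_chart_map)
    show "Ck_on k (transition d c) (chart_map d ` ?V)"
      using smooth_on_subset[OF smooth_transition[OF d c] sub(3)] by (simp add: smooth_on_def)
  qed
  have eq: "F (transition d c y) =
      tangent_lift \<A> c (chart_inv d y) (\<eta> (chart_map c (chart_inv d y))) d" if "y \<in> chart_map d ` ?V" for y
    using that d
    by (auto simp: F_def transition_chart_map chart_inv_chart_map tangent_lift_def transition_deriv_def)
  show "smooth_on (\<lambda>y. tangent_lift \<A> c (chart_inv d y) (\<eta> (chart_map c (chart_inv d y))) d)
      (chart_map d ` ?V)"
    unfolding smooth_on_def using Ck_on_cong_imp[OF od eq comp] by blast
qed (use c in \<open>auto intro: tangent_lift_in_tangent_space\<close>)

end

section \<open>The tensor field in the coordinates of one chart\<close>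

locale symmetric_tensor_in_chart = smooth_atlas M \<A>
  for M :: "'a topology" and \<A> :: "('a, 'n::finite) chart set" +
  fixes G A g lam m c
  assumes metric: "riemannian_metric M \<A> G" and tensor: "smooth_tensor_1_1 M \<A> A"
    and symm: "symmetric_tensor M \<A> G A"
    and eigen: "distinct_eigenvalues_with_multiplicities M \<A> A g lam m"
    and c: "c \<in> \<A>"
begin

abbreviation (input) lift :: "'a \<Rightarrow> real ^ 'n \<Rightarrow> ('a, 'n) tvec" where
  "lift \<equiv> tangent_lift \<A> c"

definition B :: "real ^ 'n \<Rightarrow> real ^ 'n \<Rightarrow> real ^ 'n \<Rightarrow> real" where
  "B x u v = G (chart_inv c x) (lift (chart_inv c x) u) (lift (chart_inv c x) v)"

definition L :: "real ^ 'n \<Rightarrow> real ^ 'n \<Rightarrow> real ^ 'n" where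
  "L x u = A (chart_inv c x) (lift (chart_inv c x) u) c"

lemma dom_topspace: "q \<in> chart_dom c \<Longrightarrow> q \<in> topspace M"
  using chart(1)[OF c] openin_subset by blast

lemma chart_inv_in_dom: "x \<in> chart_map c ` chart_dom c \<Longrightarrow> chart_inv c x \<in> chart_dom c"
  using chart_inv_chart_map[OF c] by auto

lemma A_tangent: "q \<in> chart_dom c \<Longrightarrow> u \<in> tangent_space \<A> q \<Longrightarrow> A q u \<in> tangent_space \<A> q"
  using tensor dom_topspace by (simp add: smooth_tensor_1_1_def)

text \<open>Since \<open>A\<close> preserves tangent spaces, lifting undoes the evaluation at
  \<open>c\<close> in the definition of \<open>L\<close>. Thus \<open>lift\<close> conjugates
  \<open>L\<close> to \<open>A\<close>.\<close>

lemma lift_L: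
  "x \<in> chart_map c ` chart_dom c \<Longrightarrow>
    lift (chart_inv c x) (L x u) = A (chart_inv c x) (lift (chart_inv c x) u)"
  unfolding L_def
  using A_tangent chart_inv_in_dom tangent_lift_in_tangent_space[OF c] tangent_lift_of_tangent[OF c]
  by metis

text \<open>The laws for \<open>G\<close> and \<open>A\<close> hold on tangent vectors only. Lifts
  are tangent vectors and depend linearly and injectively on coordinates, so the laws pull
  back.\<close>

lemma self_adjoint:
  assumes x: "x \<in> chart_map c ` chart_dom c"
  shows "self_adjoint_op (B x) (L x)"
proof (rule self_adjoint_op.intro)
  define q where "q = chart_inv c x"
  have q: "q \<in> chart_dom c" "q \<in> topspace M"
    using x chart_inv_in_dom dom_topspace by (auto simp: q_def)
  note lin = linear_tangent_lift[OF c q(1)] and T = tangent_lift_in_tangent_space[OF c q(1)]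
  have G: "G q u v = G q v u" "G q (u + w) v = G q u v + G q w v" "G q (r *\<^sub>R u) v = r * G q u v"
    "u \<noteq> 0 \<Longrightarrow> 0 < G q u u"
    if "u \<in> tangent_space \<A> q" "v \<in> tangent_space \<A> q" "w \<in> tangent_space \<A> q" for u v w r
    using metric q(2) that unfolding riemannian_metric_def by blast+
  have A: "A q (u + v) = A q u + A q v" "A q (r *\<^sub>R u) = r *\<^sub>R A q u"
    if "u \<in> tangent_space \<A> q" "v \<in> tangent_space \<A> q" for u v r
    using tensor q(2) that unfolding smooth_tensor_1_1_def by blast+
  show sym: "B x u v = B x v u" for u v
    unfolding B_def q_def[symmetric] using G(1) T by blast
  have l: "linear (\<lambda>u. B x u v)" for v
    unfolding B_def q_def[symmetric]
    by (intro linearI) (simp_all add: linear_add[OF lin] linear_scale[OF lin] G(2)[OF T T T] G(3)[OF T T T])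
  then show "bilinear (B x)"
    unfolding bilinear_def using l sym by (metis (no_types, lifting) ext)
  show "0 < B x v v" if "v \<noteq> 0" for v
  proof -
    have "lift q v \<noteq> 0"
      using that tangent_lift_apply[OF c q(1), of v] by (auto simp: zero_fun_def)
    then show ?thesis unfolding B_def q_def[symmetric] using G(4) T by blast
  qed
  show "linear (L x)"
    unfolding L_def q_def[symmetric]
    by (intro linearI, simp_all only: linear_add[OF lin] linear_scale[OF lin] A[OF T T])
      (simp_all add: plus_fun_def scaleR_fun_def)
  show "B x (L x u) v = B x u (L x v)" for u v
    unfolding B_def lift_L[OF x] unfolding q_def[symmetric]
    using symm q(2) T unfolding symmetric_tensor_def by blast
qed

text \<open>Eigenvectors correspond under the isomorphism \<open>lift\<close> and evaluation at
  \<open>c\<close>, so \<open>L x\<close> and \<open>A\<close> have the same eigenvalues.\<close>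

lemma eigenvalues_L:
  assumes x: "x \<in> chart_map c ` chart_dom c"
  shows "eigenvalues (L x) = {lam i (chart_inv c x) |i. i \<in> {1..g}}"
proof -
  define q where "q = chart_inv c x"
  have q: "q \<in> chart_dom c" "q \<in> topspace M"
    using x chart_inv_in_dom dom_topspace by (auto simp: q_def)
  have "\<mu> \<in> eigenvalues (L x) \<longleftrightarrow> eigenvalue_at \<A> A q \<mu>" for \<mu>
  proof
    assume "\<mu> \<in> eigenvalues (L x)"
    then obtain v where v: "v \<noteq> 0" "L x v = \<mu> *\<^sub>R v" by (auto simp: eigenvalues_def)
    have "A q (lift q v) = \<mu> *\<^sub>R lift q v"
      using lift_L[OF x, of v] v(2) linear_scale[OF linear_tangent_lift[OF c q(1)]] by (simp add: q_def)
    moreover have "lift q v \<noteq> 0"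
      using v(1) tangent_lift_apply[OF c q(1), of v] by (auto simp: zero_fun_def)
    ultimately show "eigenvalue_at \<A> A q \<mu>"
      using tangent_lift_in_tangent_space[OF c q(1)]
      by (auto simp: eigenvalue_at_def eigenvector_at_def eigenspace_at_def)
  next
    assume "eigenvalue_at \<A> A q \<mu>"
    then obtain v where v: "v \<in> tangent_space \<A> q" "A q v = \<mu> *\<^sub>R v" "v \<noteq> 0"
      by (auto simp: eigenvalue_at_def eigenvector_at_def eigenspace_at_def)
    have "lift q (v c) = v" using tangent_lift_of_tangent[OF c q(1) v(1)] .
    then have "L x (v c) = \<mu> *\<^sub>R v c" "v c \<noteq> 0"
      using v linear_0[OF linear_tangent_lift[OF c q(1)]]
      by (auto simp: L_def q_def[symmetric] scaleR_fun_def)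
    then show "\<mu> \<in> eigenvalues (L x)" by (auto simp: eigenvalues_def)
  qed
  then have "eigenvalues (L x) = {\<mu>. eigenvalue_at \<A> A q \<mu>}" by blast
  then show ?thesis
    using eigen q(2) by (simp add: distinct_eigenvalues_with_multiplicities_def q_def)
qed

lemma vec_expansion: "(\<Sum>i\<in>UNIV. (u $ i) *\<^sub>R axis i (1::real)) = u"
  using basis_expansion[of u] by (simp add: scalar_mult_eq_scaleR)

text \<open>The metric and tensor are given as smooth on coordinate vectors; expanding in
  \<open>axis\<close> vectors extends this to all fixed vectors. Pointwise distinctness of the
  \<open>lam i\<close> gives exactly \<open>g\<close> eigenvalues.\<close>

sublocale self_adjoint_family "chart_map c ` chart_dom c" B L g
proof (rule self_adjoint_family.intro)
  let ?S = "chart_map c ` chart_dom c"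
  show S: "open ?S" using chart(2)[OF c] .
  show "self_adjoint_op (B x) (L x)" if "x \<in> ?S" for x using self_adjoint[OF that] .
  show "smooth_on (\<lambda>x. B x u v) ?S" for u v
    unfolding smooth_on_def
  proof (intro allI, rule Ck_on_cong_imp[OF S])
    fix k
    have "smooth_on (\<lambda>x. B x (axis i 1) (axis j 1)) ?S" for i j
      using metric c by (simp add: riemannian_metric_def Let_def coord_vec_eq_lift B_def)
    then have "Ck_on k (\<lambda>x. B x (axis i 1) (axis j 1)) ?S" for i j
      by (simp add: smooth_on_def)
    then show "Ck_on k (\<lambda>x. \<Sum>i\<in>UNIV. \<Sum>j\<in>UNIV. v $ j * (u $ i * B x (axis i 1) (axis j 1))) ?S"
      by (intro Ck_on_sum Ck_on_mult Ck_on_const S)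
    fix x assume "x \<in> ?S"
    then interpret self_adjoint_op "B x" "L x" by (rule self_adjoint)
    have "B x (\<Sum>i\<in>UNIV. (u $ i) *\<^sub>R axis i 1) (\<Sum>j\<in>UNIV. (v $ j) *\<^sub>R axis j 1)
      = (\<Sum>i\<in>UNIV. \<Sum>j\<in>UNIV. v $ j * (u $ i * B x (axis i 1) (axis j 1)))"
      by (simp only: bilinear_sum[OF bilin] sum.cartesian_product[symmetric] bilin_simps real_scaleR_def)
    then show "(\<Sum>i\<in>UNIV. \<Sum>j\<in>UNIV. v $ j * (u $ i * B x (axis i 1) (axis j 1))) = B x u v"
      by (simp only: vec_expansion)
  qed
  show "smooth_on (\<lambda>x. L x u) ?S" for u
    unfolding smooth_on_def
  proof (intro allI, rule Ck_on_cong_imp[OF S])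
    fix k
    have "Ck_on k (\<lambda>x. L x (axis j 1) $ i) ?S" for i j
      using tensor c unfolding smooth_tensor_1_1_def Let_def coord_vec_eq_lift L_def smooth_on_def by blast
    then show "Ck_on k (\<lambda>x. \<Sum>j\<in>UNIV. (u $ j) *\<^sub>R (\<Sum>i\<in>UNIV. (L x (axis j 1) $ i) *\<^sub>R axis i 1)) ?S"
      by (intro Ck_on_sum Ck_on_scaleR Ck_on_const S)
    fix x assume "x \<in> ?S"
    then interpret self_adjoint_op "B x" "L x" by (rule self_adjoint)
    have "(\<Sum>j\<in>UNIV. (u $ j) *\<^sub>R L x (axis j 1)) = L x (\<Sum>j\<in>UNIV. (u $ j) *\<^sub>R axis j 1)"
      by (simp add: linear_sum[OF lin] linear_scale[OF lin])
    then show "(\<Sum>j\<in>UNIV. (u $ j) *\<^sub>R (\<Sum>i\<in>UNIV. (L x (axis j 1) $ i) *\<^sub>R axis i 1)) = L x u"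
      by (simp only: vec_expansion)
  qed
  show "finite (eigenvalues (L x))" if "x \<in> ?S" for x
    using eigenvalues_L[OF that] by simp
  show "card (eigenvalues (L x)) = g" if x: "x \<in> ?S" for x
  proof -
    have "chart_inv c x \<in> topspace M" using x chart_inv_in_dom dom_topspace by blast
    then have "inj_on (\<lambda>i. lam i (chart_inv c x)) {1..g}"
      using eigen by (simp add: distinct_eigenvalues_with_multiplicities_def)
    moreover have "eigenvalues (L x) = (\<lambda>i. lam i (chart_inv c x)) ` {1..g}"
      unfolding eigenvalues_L[OF x] by blast
    ultimately show ?thesis by (simp add: card_image)
  qed
qed

lemma eigenframe:
  assumes p: "p \<in> chart_dom c"
  shows "\<exists>U X. openin M U \<and> p \<in> U \<and> smooth_orthonormal_frame_on \<A> G U X \<and>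
    (\<forall>i\<in>{1..CARD('n)}. \<forall>q\<in>U. \<exists>\<mu>. eigenvector_at \<A> A q \<mu> (X i q))"
proof -
  let ?n = "CARD('n)"
  obtain T \<xi> where T: "open T" "chart_map c p \<in> T" "T \<subseteq> chart_map c ` chart_dom c"
    and sm: "\<forall>i<?n. smooth_on (\<xi> i) T"
    and on_eig: "\<forall>x\<in>T. self_adjoint_op.orthonormal (B x) ?n (\<lambda>i. \<xi> i x) \<and>
      (\<forall>i<?n. \<exists>\<mu>. L x (\<xi> i x) = \<mu> *\<^sub>R \<xi> i x)"
    using orthonormal_eigenvector_fields[of "chart_map c p" ?n] p by (simp, elim exE conjE)
  define U where "U = {q \<in> chart_dom c. chart_map c q \<in> T}"
  \<comment> \<open>The fields \<open>\<xi>\<close> are numbered from 0 and the frame from 1.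
    Natural subtraction of 1 is injective here because the frame indices are positive.\<close>
  define X where "X i q = lift q (\<xi> (i - 1) (chart_map c q))" for i q
  have U: "openin M U" "p \<in> U"
    using openin_chart_preimage[OF c T(1)] p T(2) by (auto simp: U_def)
  have field: "smooth_vector_field_on \<A> U (X i)" if "i \<in> {1..?n}" for i
    unfolding U_def X_def using that by (intro smooth_vector_field_lift c T sm[rule_format]) auto
  have pt: "inj_on (\<lambda>i. X i q) {1..?n} \<and> independent ((\<lambda>i. X i q) ` {1..?n}) \<and>
      span ((\<lambda>i. X i q) ` {1..?n}) = tangent_space \<A> q \<and>
      (\<forall>i\<in>{1..?n}. \<forall>j\<in>{1..?n}. G q (X i q) (X j q) = (if i = j then 1 else 0)) \<and>
      (\<forall>i\<in>{1..?n}. \<exists>\<mu>. eigenvector_at \<A> A q \<mu> (X i q))" if "q \<in> U" for q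
  proof -
    define x where "x = chart_map c q"
    have q: "q \<in> chart_dom c" and x: "x \<in> T" "x \<in> chart_map c ` chart_dom c"
      using that T by (auto simp: U_def x_def)
    have inv: "chart_inv c x = q" using chart_inv_chart_map[OF c q] by (simp add: x_def)
    interpret P: self_adjoint_op "B x" "L x" using self_adjoint[OF x(2)] .
    let ?\<Xi> = "(\<lambda>i. \<xi> i x) ` {..<?n}"
    have on': "P.orthonormal ?n (\<lambda>i. \<xi> i x)" using on_eig x(1) by blast
    note ind = P.orthonormal_independent[OF on'] and lin = linear_tangent_lift[OF c q]
    have X: "X i q = lift q (\<xi> (i - 1) x)" for i by (simp add: X_def x_def)
    have pred: "(\<lambda>i. i - 1) ` {1..?n} = {..<?n}"
      by (force simp: image_iff intro: bexI[of _ "Suc _"])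
    have img: "(\<lambda>i. X i q) ` {1..?n} = lift q ` ?\<Xi>"
      unfolding X pred[symmetric] by (simp add: image_image)
    have 1: "inj_on (\<lambda>i. X i q) {1..?n}"
    proof (rule inj_onI)
      fix i j assume ij: "i \<in> {1..?n}" "j \<in> {1..?n}" "X i q = X j q"
      then have "\<xi> (i - 1) x = \<xi> (j - 1) x"
        using inj_tangent_lift[OF c q] by (auto simp: X inj_def)
      moreover have "i - 1 \<in> {..<?n}" "j - 1 \<in> {..<?n}" using ij(1,2) by auto
      ultimately have "i - 1 = j - 1"
        using inj_onD[OF ind(1)] by blast
      then show "i = j" using ij(1,2) by auto
    qed
    have 2: "independent (lift q ` ?\<Xi>)"
      using linear_independent_injective_image[OF lin ind(2)] inj_tangent_lift[OF c q] inj_on_subset by blast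
    have "u \<in> span ?\<Xi>" for u
    proof -
      have "u = (\<Sum>i<?n. B x u (\<xi> i x) *\<^sub>R \<xi> i x)"
        using P.orthonormal_expand[of "\<lambda>i. \<xi> i x" u] on' by simp
      also have "\<dots> \<in> span ?\<Xi>"
        by (intro span_sum span_scale span_base) auto
      finally show ?thesis .
    qed
    then have 3: "span (lift q ` ?\<Xi>) = tangent_space \<A> q"
      unfolding linear_span_image[OF lin] range_tangent_lift[OF c q, symmetric] by blast
    have B1: "B x (\<xi> i x) (\<xi> j x) = (if i = j then 1 else 0)" if "i < ?n" "j < ?n" for i j
      using on' that by (simp add: P.orthonormal_def)
    have 4: "G q (X i q) (X j q) = (if i = j then 1 else 0)" if "i \<in> {1..?n}" "j \<in> {1..?n}" for i j
    proof -
      have "G q (X i q) (X j q) = B x (\<xi> (i - 1) x) (\<xi> (j - 1) x)"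
        by (simp add: B_def inv X)
      then show ?thesis using B1[of "i - 1" "j - 1"] that by auto
    qed
    have 5: "\<exists>\<mu>. eigenvector_at \<A> A q \<mu> (X i q)" if i: "i \<in> {1..?n}" for i
    proof -
      have i': "i - 1 < ?n" using i by auto
      then obtain \<mu> where \<mu>: "L x (\<xi> (i - 1) x) = \<mu> *\<^sub>R \<xi> (i - 1) x" using on_eig x(1) by blast
      have "A q (X i q) = \<mu> *\<^sub>R X i q"
        using lift_L[OF x(2), of "\<xi> (i - 1) x"] unfolding inv X \<mu> linear_scale[OF lin] by simp
      moreover have "\<xi> (i - 1) x \<noteq> 0"
        using B1[OF i' i'] P.eq_0_iff[of "\<xi> (i - 1) x"] by auto
      then have "X i q \<noteq> 0"
        using tangent_lift_apply[OF c q, of "\<xi> (i - 1) x"] unfolding X by (auto simp: zero_fun_def)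
      ultimately show ?thesis
        using tangent_lift_in_tangent_space[OF c q]
        by (auto simp: eigenvector_at_def eigenspace_at_def X)
    qed
    show ?thesis using 1 2 3 4 5 unfolding img by blast
  qed
  have "smooth_orthonormal_frame_on \<A> G U X"
    unfolding smooth_orthonormal_frame_on_def smooth_frame_on_def
    by (intro conjI ballI field; use pt in blast)
  then show ?thesis using U pt by blast
qed

end

theorem theorem3p1:
  fixes M :: "'a topology"
    and \<A> \<O> :: "('a, 'n::finite) chart set"
    and G :: "'a \<Rightarrow> ('a, 'n) tvec \<Rightarrow> ('a, 'n) tvec \<Rightarrow> real"
    and A :: "'a \<Rightarrow> ('a, 'n) tvec \<Rightarrow> ('a, 'n) tvec"
    and g :: nat
    and lam :: "nat \<Rightarrow> 'a \<Rightarrow> real"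
    and m :: "nat \<Rightarrow> nat"
  assumes "oriented_riemannian_manifold M \<A> \<O> G"
    and "CARD('n) \<ge> 2"
    and "smooth_tensor_1_1 M \<A> A"
    and "symmetric_tensor M \<A> G A"
    and "distinct_eigenvalues_with_multiplicities M \<A> A g lam m"
  shows "\<forall>p\<in>topspace M. \<exists>U X. openin M U \<and> p \<in> U \<and>
           smooth_orthonormal_frame_on \<A> G U X \<and>
           (\<forall>i\<in>{1..CARD('n)}. \<forall>q\<in>U. \<exists>\<mu>. eigenvector_at \<A> A q \<mu> (X i q))"
proof
  fix p assume "p \<in> topspace M"
  have man: "smooth_manifold M \<A>" "riemannian_metric M \<A> G"
    using assms(1) by (auto simp: oriented_riemannian_manifold_def)
  \<comment> \<open>The claim is local, so one chart around \<open>p\<close> suffices.\<close>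
  have "(\<Union>c\<in>\<A>. chart_dom c) = topspace M"
    using man(1) unfolding smooth_manifold_def by blast
  then obtain c where c: "c \<in> \<A>" and p: "p \<in> chart_dom c"
    using \<open>p \<in> topspace M\<close> by blast
  interpret symmetric_tensor_in_chart M \<A> G A g lam m c
    by (intro symmetric_tensor_in_chart.intro smooth_atlas.intro symmetric_tensor_in_chart_axioms.intro
        man assms(3-5) c)
  show "\<exists>U X. openin M U \<and> p \<in> U \<and> smooth_orthonormal_frame_on \<A> G U X \<and>
           (\<forall>i\<in>{1..CARD('n)}. \<forall>q\<in>U. \<exists>\<mu>. eigenvector_at \<A> A q \<mu> (X i q))"
    using eigenframe[OF p] .
qed

end
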